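(* Let $K$ be a field of characteristic $0$, let $n\ge 2$, and let $f\in\mathrm{Nov}(n)$ be an element of the multilinear component of the free Novikov algebra $\mathrm{Nov}\langle X\rangle$ over $K$ on $X=\{x_1,\ldots,x_n\}$, with symbol $P_f\in K[t_1,\ldots,t_n]$. Put $$V_n=\{a=(a_1,\ldots,a_n)\in\mathbb Z^n\mid a_i\le 1\ (1\le i\le n),\ a_1+\cdots+a_n\ge 2\}.$$ Then $f$ is a Lie element if and only if $P_f(a)=0$ for every $a\in V_n$.
   Context: A Novikov algebra over $K$ is a (nonassociative) algebra $(N,\circ)$ satisfying $(a\circ b)\circ c-a\circ(b\circ c)=(b\circ a)\circ c-b\circ(a\circ c)$ and $(a\circ b)\circ c=(a\circ c)\circ b$. Its commutator $[a,b]=a\circ b-b\circ a$ satisfies the Jacobi identity; the resulting Lie algebra is denoted $N^{(-)}$. Let $X=\{x_1,\ldots,x_n\}$ and let $K\{X\}=K[x_i^{(r)}\mid 1\le i\le n,\ r\ge 0]$ be the free commutative differential algebra, with $x_i=x_i^{(0)}$ and derivation $D$ given by $D(x_i^{(r)})=x_i^{(r+1)}$. With the product $f\circ g=f\,D(g)$ it is a Novikov algebra, and (Dzhumadil'daev–Löfwall) the subalgebra of $(K\{X\},\circ)$ generated by $X$ is the free Novikov algebra $\mathrm{Nov}\langle X\rangle$ on $X$; we identify the two. $\mathrm{Nov}(n)$ denotes the multilinear component of $\mathrm{Nov}\langle X\rangle$ in $x_1,\ldots,x_n$; it has as basis the differential monomials $x_1^{(\alpha_1)}\cdots x_n^{(\alpha_n)}$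 with $\alpha\in\mathbb Z_{\ge0}^n$, $\alpha_1+\cdots+\alpha_n=n-1$. The symbol $P_f$ of $f\in\mathrm{Nov}(n)$ is its image under the linear isomorphism $x_1^{(\alpha_1)}\cdots x_n^{(\alpha_n)}\mapsto t_1^{\alpha_1}\cdots t_n^{\alpha_n}$ from $\mathrm{Nov}(n)$ onto the space of homogeneous polynomials of degree $n-1$ in $K[t_1,\ldots,t_n]$. An element of $\mathrm{Nov}\langle X\rangle$ is a Lie element if it belongs to the Lie subalgebra of $\mathrm{Nov}\langle X\rangle^{(-)}$ generated by $X$. *)

theory Defs
  imports Complex_Main "HOL-Library.Poly_Mapping" "HOL-Library.FuncSet"
begin

section \<open>Differential polynomials\<close>

text \<open>
  Commutative polynomials are elements of the monoid algebra of the free commutative monoid of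
  exponent vectors. The variable \<open>(i, r)\<close> stands for \<open>x\<^sub>i\<^sup>(\<^sup>r\<^sup>)\<close>, and \<open>x\<^sub>i\<close> is available for every natural
  number \<open>i\<close>; the objects attached to \<open>X = {x\<^sub>1, \<dots>, x\<^sub>n}\<close> below only involve indices in \<open>{1..n}\<close>.
\<close>

type_synonym diff_monom = "(nat \<times> nat) \<Rightarrow>\<^sub>0 nat"
type_synonym 'k diff_poly = "diff_monom \<Rightarrow>\<^sub>0 'k"

definition const :: "'k \<Rightarrow> 'a::zero \<Rightarrow>\<^sub>0 'k::zero" where
  "const c = Poly_Mapping.single 0 c"

definition dvar :: "nat \<Rightarrow> nat \<Rightarrow> 'k::field diff_poly" where
  "dvar i r = Poly_Mapping.single (Poly_Mapping.single (i, r) 1) 1"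

text \<open>The Leibniz rule on monomials and its linear extension.\<close>

definition deriv_monom :: "diff_monom \<Rightarrow> 'k::field diff_poly" where
  "deriv_monom m = (\<Sum>(i, r)\<in>Poly_Mapping.keys m.
     Poly_Mapping.single
       (m - Poly_Mapping.single (i, r) 1 + Poly_Mapping.single (i, Suc r) 1)
       (of_nat (Poly_Mapping.lookup m (i, r))))"

definition D :: "'k::field diff_poly \<Rightarrow> 'k diff_poly" where
  "D f = (\<Sum>m\<in>Poly_Mapping.keys f. const (Poly_Mapping.lookup f m) * deriv_monom m)"

lemma D_superset:
  assumes "finite A" "Poly_Mapping.keys f \<subseteq> A"
  shows "D f = (\<Sum>m\<in>A. const (Poly_Mapping.lookup f m) * deriv_monom m)"
  unfolding D_def
  by (rule sum.mono_neutral_left) (use assms in \<open>auto simp: in_keys_iff const_def\<close>)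

lemma D_add: "D (f + g) = D f + D g"
proof -
  let ?A = "Poly_Mapping.keys f \<union> Poly_Mapping.keys g"
  have "Poly_Mapping.keys (f + g) \<subseteq> ?A" by (rule Poly_Mapping.keys_add)
  then show ?thesis
    by (simp add: D_superset[of ?A] lookup_add const_def single_add distrib_right sum.distrib)
qed

lemma D_zero [simp]: "D 0 = 0"
  by (simp add: D_def)

lemma D_sum: "D (\<Sum>i\<in>A. f i) = (\<Sum>i\<in>A. D (f i))"
  by (induction A rule: infinite_finite_induct) (auto simp: D_add)

lemma D_single: "D (Poly_Mapping.single m c) = const c * deriv_monom m"
  by (subst D_superset[of "{m}"]) auto

lemma D_dvar: "D (dvar i r) = dvar i (Suc r)"
  by (simp add: dvar_def D_single deriv_monom_def const_def mult_single)

lemma deriv_monom_superset: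
  assumes "finite A" "Poly_Mapping.keys m \<subseteq> A"
  shows "deriv_monom m = (\<Sum>(i, r)\<in>A.
     Poly_Mapping.single
       (m - Poly_Mapping.single (i, r) 1 + Poly_Mapping.single (i, Suc r) 1)
       (of_nat (Poly_Mapping.lookup m (i, r))))"
  unfolding deriv_monom_def
  by (rule sum.mono_neutral_left) (use assms in \<open>auto simp: in_keys_iff\<close>)

lemma minus_single_add:
  fixes m m' :: diff_monom
  assumes "Poly_Mapping.lookup m v \<noteq> 0"
  shows "m - Poly_Mapping.single v 1 + m' = m + m' - Poly_Mapping.single v 1"
  by (rule poly_mapping_eqI) (use assms in \<open>auto simp: lookup_add lookup_minus lookup_single when_def\<close>)

lemma deriv_monom_add:
  "deriv_monom (m + m') =
     deriv_monom m * Poly_Mapping.single m' 1 + Poly_Mapping.single m 1 * (deriv_monom m' :: 'k::field diff_poly)"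
proof -
  let ?A = "Poly_Mapping.keys m \<union> Poly_Mapping.keys m'"
  have sub: "Poly_Mapping.keys (m + m') \<subseteq> ?A" by (rule Poly_Mapping.keys_add)
  let ?s = "\<lambda>m i r (c::nat). Poly_Mapping.single
       (m - Poly_Mapping.single (i, r) 1 + Poly_Mapping.single (i, Suc r) (1::nat)) (of_nat c :: 'k)"
  have 1: "?s m i r (Poly_Mapping.lookup m (i,r)) * Poly_Mapping.single m' 1
      = ?s (m + m') i r (Poly_Mapping.lookup m (i,r))" for i r and m m' :: diff_monom
  proof (cases "Poly_Mapping.lookup m (i,r) = 0")
    case False
    have "m - Poly_Mapping.single (i, r) 1 + Poly_Mapping.single (i, Suc r) 1 + m'
        = m + m' - Poly_Mapping.single (i, r) 1 + Poly_Mapping.single (i, Suc r) 1"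
      unfolding minus_single_add[OF False, of m', symmetric] by (simp only: add_ac)
    then show ?thesis
      by (simp only: mult_single mult_1_right)
  qed simp
  have 2: "Poly_Mapping.single m 1 * ?s m' i r (Poly_Mapping.lookup m' (i,r))
      = ?s (m + m') i r (Poly_Mapping.lookup m' (i,r))" for i r
    using 1[of m' i r m] by (simp add: add.commute mult.commute)
  have "deriv_monom (m + m') = (\<Sum>(i, r)\<in>?A. ?s (m + m') i r (Poly_Mapping.lookup (m + m') (i,r)))"
    using sub by (subst deriv_monom_superset[of ?A]) auto
  also have "\<dots> = (\<Sum>(i, r)\<in>?A. ?s m i r (Poly_Mapping.lookup m (i,r)) * Poly_Mapping.single m' 1
       + Poly_Mapping.single m 1 * ?s m' i r (Poly_Mapping.lookup m' (i,r)))"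
    unfolding 1 2 by (simp add: lookup_add single_add split_def)
  also have "\<dots> = (\<Sum>(i, r)\<in>?A. ?s m i r (Poly_Mapping.lookup m (i,r))) * Poly_Mapping.single m' 1
       + Poly_Mapping.single m 1 * (\<Sum>(i, r)\<in>?A. ?s m' i r (Poly_Mapping.lookup m' (i,r)))"
    by (simp add: split_def sum.distrib sum_distrib_left sum_distrib_right)
  also have "\<dots> = deriv_monom m * Poly_Mapping.single m' 1 + Poly_Mapping.single m 1 * deriv_monom m'"
    by (simp add: deriv_monom_superset[of ?A m] deriv_monom_superset[of ?A m'])
  finally show ?thesis .
qed

lemma diff_poly_sum_single:
  "f = (\<Sum>m\<in>Poly_Mapping.keys f. Poly_Mapping.single m (Poly_Mapping.lookup f m))"
  by (rule poly_mapping_eqI)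
    (auto simp: lookup_sum lookup_single when_def in_keys_iff sum.delta')

lemma D_mult_single:
  "D (Poly_Mapping.single m c * Poly_Mapping.single m' c') =
     D (Poly_Mapping.single m c) * Poly_Mapping.single m' c'
     + Poly_Mapping.single m c * D (Poly_Mapping.single m' (c'::'k::field))"
proof -
  have s: "Poly_Mapping.single k a = const a * Poly_Mapping.single k 1" for k :: diff_monom and a :: 'k
    by (simp add: const_def mult_single)
  have "D (Poly_Mapping.single m c * Poly_Mapping.single m' c') = const (c * c') * deriv_monom (m + m')"
    by (simp add: mult_single D_single)
  moreover have cc: "const (c * c') = (const c * const c' :: 'k diff_poly)"
    by (simp add: const_def mult_single)
  moreover have "D (Poly_Mapping.single m c) * Poly_Mapping.single m' c'
      = const c * deriv_monom m * (const c' * Poly_Mapping.single m' 1)"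
    unfolding D_single by (subst s[of m' c']) (rule refl)
  moreover have "Poly_Mapping.single m c * D (Poly_Mapping.single m' c')
      = const c * Poly_Mapping.single m 1 * (const c' * deriv_monom m')"
    unfolding D_single by (subst s[of m c]) (rule refl)
  ultimately show ?thesis
    by (simp only: deriv_monom_add distrib_left mult_ac)
qed

lemma D_mult: "D (f * g) = D f * g + f * D g"
proof -
  let ?F = "\<lambda>m. Poly_Mapping.single m (Poly_Mapping.lookup f m)"
  let ?G = "\<lambda>m. Poly_Mapping.single m (Poly_Mapping.lookup g m)"
  let ?A = "Poly_Mapping.keys f" and ?B = "Poly_Mapping.keys g"
  have "D (sum ?F ?A * sum ?G ?B) = D (sum ?F ?A) * sum ?G ?B + sum ?F ?A * D (sum ?G ?B)"
    by (simp add: sum_product D_sum D_mult_single sum.distrib)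
  then show ?thesis by (simp flip: diff_poly_sum_single)
qed

lemma D_const: "D (const c) = 0"
  by (simp add: const_def D_single deriv_monom_def)

section \<open>The free Novikov algebra and its Lie elements\<close>

definition nov_mult :: "'k::field diff_poly \<Rightarrow> 'k diff_poly \<Rightarrow> 'k diff_poly" where
  "nov_mult f g = f * D g"

lemma nov_left_symmetric:
  "nov_mult (nov_mult a b) c - nov_mult a (nov_mult b c)
   = nov_mult (nov_mult b a) c - nov_mult b (nov_mult a c)"
  by (simp add: nov_mult_def D_mult algebra_simps)

lemma nov_right_commutative:
  "nov_mult (nov_mult a b) c = nov_mult (nov_mult a c) b"
  by (simp add: nov_mult_def algebra_simps)

definition nov_bracket :: "'k::field diff_poly \<Rightarrow> 'k diff_poly \<Rightarrow> 'k diff_poly" where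
  "nov_bracket f g = nov_mult f g - nov_mult g f"

text \<open>The smallest linear subspace that contains \<open>S\<close> and is closed under the bilinear product \<open>p\<close>.\<close>

inductive_set generated_subalgebra ::
  "('k diff_poly \<Rightarrow> 'k diff_poly \<Rightarrow> 'k diff_poly) \<Rightarrow> 'k::field diff_poly set \<Rightarrow> 'k diff_poly set"
  for p :: "'k diff_poly \<Rightarrow> 'k diff_poly \<Rightarrow> 'k diff_poly" and S :: "'k diff_poly set" where
  zero: "0 \<in> generated_subalgebra p S"
| gen: "f \<in> S \<Longrightarrow> f \<in> generated_subalgebra p S"
| add: "f \<in> generated_subalgebra p S \<Longrightarrow> g \<in> generated_subalgebra p S
        \<Longrightarrow> f + g \<in> generated_subalgebra p S"
| scale: "f \<in> generated_subalgebra p S \<Longrightarrow> const c * f \<in> generated_subalgebra p S"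
| mult: "f \<in> generated_subalgebra p S \<Longrightarrow> g \<in> generated_subalgebra p S
        \<Longrightarrow> p f g \<in> generated_subalgebra p S"

definition gens :: "nat \<Rightarrow> 'k::field diff_poly set" where
  "gens n = (\<lambda>i. dvar i 0) ` {1..n}"

text \<open>
  By the theorem of Dzhumadil'daev and Loefwall, this subalgebra is the free Novikov algebra on
  \<open>X = {x\<^sub>1, \<dots>, x\<^sub>n}\<close>.
\<close>

definition Nov_free :: "nat \<Rightarrow> 'k::field diff_poly set" where
  "Nov_free n = generated_subalgebra nov_mult (gens n)"

definition lie_elements :: "nat \<Rightarrow> 'k::field diff_poly set" where
  "lie_elements n = generated_subalgebra nov_bracket (gens n)"

lemma lie_elements_subset_Nov_free: "lie_elements n \<subseteq> (Nov_free n :: 'k::field diff_poly set)"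
proof
  fix f :: "'k diff_poly" assume "f \<in> lie_elements n"
  then show "f \<in> Nov_free n"
    unfolding lie_elements_def
  proof induction
    case (mult f g)
    have "const (- 1) * nov_mult g f \<in> Nov_free n" "nov_mult f g \<in> Nov_free n"
      using mult by (auto simp: Nov_free_def intro: generated_subalgebra.intros)
    moreover have "nov_bracket f g = nov_mult f g + const (- 1) * nov_mult g f"
      by (simp add: nov_bracket_def const_def single_uminus)
    ultimately show ?case
      by (auto simp: Nov_free_def intro: generated_subalgebra.intros)
  qed (auto simp: Nov_free_def intro: generated_subalgebra.intros)
qed

text \<open>The degree of a differential monomial in \<open>x\<^sub>i\<close>, counting all derivatives of \<open>x\<^sub>i\<close>.\<close>

definition degree_in :: "nat \<Rightarrow> diff_monom \<Rightarrow> nat" where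
  "degree_in i m = (\<Sum>v\<in>{v \<in> Poly_Mapping.keys m. fst v = i}. Poly_Mapping.lookup m v)"

text \<open>
  Elements of \<^term>\<open>Nov_free n\<close> involve no \<open>x\<^sub>i\<close> with \<open>i\<close> outside \<open>{1..n}\<close>, so only the degrees in
  \<open>x\<^sub>1, \<dots>, x\<^sub>n\<close> have to be prescribed.
\<close>

definition Nov :: "nat \<Rightarrow> 'k::field diff_poly set" where
  "Nov n = {f \<in> Nov_free n. \<forall>m\<in>Poly_Mapping.keys f. \<forall>i\<in>{1..n}. degree_in i m = 1}"

section \<open>Symbols\<close>

text \<open>\<open>K[t\<^sub>1, t\<^sub>2, \<dots>]\<close>, with \<open>t\<^sub>i\<close> represented by its index \<open>i\<close>.\<close>

type_synonym 'k sym_poly = "(nat \<Rightarrow>\<^sub>0 nat) \<Rightarrow>\<^sub>0 'k"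

text \<open>
  The exponent of \<open>t\<^sub>i\<close> attached to a monomial is the total order of differentiation on \<open>x\<^sub>i\<close>; for
  \<open>x\<^sub>1\<^sup>(\<^sup>\<alpha>\<^sup>1\<^sup>) \<cdots> x\<^sub>n\<^sup>(\<^sup>\<alpha>\<^sup>n\<^sup>)\<close> it is \<open>\<alpha>\<^sub>i\<close> (lemma \<open>symbol_multilinear_monomial\<close>). Thus \<open>symbol\<close>, although total,
  restricts on \<^term>\<open>Nov n\<close> to the symbol map.
\<close>

definition symbol_monom :: "diff_monom \<Rightarrow> (nat \<Rightarrow>\<^sub>0 nat)" where
  "symbol_monom m = (\<Sum>(i, r)\<in>Poly_Mapping.keys m.
     Poly_Mapping.single i (r * Poly_Mapping.lookup m (i, r)))"

definition symbol :: "'k::field diff_poly \<Rightarrow> 'k sym_poly" where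
  "symbol f = (\<Sum>m\<in>Poly_Mapping.keys f. Poly_Mapping.single (symbol_monom m) (Poly_Mapping.lookup f m))"

definition eval_poly :: "(nat \<Rightarrow> 'k) \<Rightarrow> 'k::field sym_poly \<Rightarrow> 'k" where
  "eval_poly a P = (\<Sum>m\<in>Poly_Mapping.keys P. Poly_Mapping.lookup P m *
     (\<Prod>i\<in>Poly_Mapping.keys m. a i ^ Poly_Mapping.lookup m i))"

lemma prod_dvar:
  assumes "finite I"
  shows "(\<Prod>i\<in>I. dvar i (\<alpha> i)) =
    (Poly_Mapping.single (\<Sum>i\<in>I. Poly_Mapping.single (i, \<alpha> i) 1) 1 :: 'k::field diff_poly)"
  using assms by (induction rule: finite_induct) (auto simp: dvar_def mult_single)

lemma symbol_multilinear_monomial: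
  "symbol (\<Prod>i\<in>{1..n}. dvar i (\<alpha> i) :: 'k::field diff_poly)
   = Poly_Mapping.single (\<Sum>i\<in>{1..n}. Poly_Mapping.single i (\<alpha> i)) 1"
proof -
  let ?m = "(\<Sum>i\<in>{1..n}. Poly_Mapping.single (i, \<alpha> i) 1) :: diff_monom"
  have l: "Poly_Mapping.lookup ?m v = (if fst v \<in> {1..n} \<and> snd v = \<alpha> (fst v) then 1 else 0)" for v
  proof -
    have "Poly_Mapping.lookup ?m v = (\<Sum>i\<in>{1..n}. if i = fst v then (if snd v = \<alpha> i then 1 else 0) else 0)"
      unfolding lookup_sum by (rule sum.cong) (auto simp: lookup_single when_def prod_eq_iff)
    then show ?thesis by (simp add: sum.delta)
  qed
  have k: "Poly_Mapping.keys ?m = (\<lambda>i. (i, \<alpha> i)) ` {1..n}"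
    unfolding set_eq_iff in_keys_iff l by auto
  have "symbol_monom ?m = (\<Sum>i\<in>{1..n}. Poly_Mapping.single i (\<alpha> i))"
    unfolding symbol_monom_def k
    by (subst sum.reindex) (auto simp only: inj_on_def l split_def comp_def fst_conv snd_conv prod.inject
      if_True simp_thms mult_1_right intro!: sum.cong)
  then show ?thesis
    by (simp add: prod_dvar symbol_def)
qed

definition V :: "nat \<Rightarrow> (nat \<Rightarrow> int) set" where
  "V n = {a \<in> {1..n} \<rightarrow>\<^sub>E UNIV. (\<forall>i\<in>{1..n}. a i \<le> 1) \<and> (\<Sum>i\<in>{1..n}. a i) \<ge> 2}"

end

(* Substituting e^(a_i z) for x_i turns f in Nov(n) into P_f(a) e^((a_1 + ... + a_n) z), and the
   vector fields e_a = e^(az) satisfy [e_a, e_b] = (b - a) e_(a + b). The e_a with a <= 1 span a Lie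
   subalgebra, because [e_1, e_1] = 0; hence Lie elements vanish on V_n.

   For the converse, call a homogeneous polynomial of degree d in |I| variables admissible if it
   vanishes at all integer points with coordinates <= 1 and coordinate sum >= |I| - d + 1. For d < |I|
   the admissible polynomials are exactly the sums of products of |I| - d symbols of Lie elements on
   disjoint sets of variables; d = n - 1 is the theorem. The proof is by induction on |I|. Coefficients
   of top degree in one or two variables are again admissible, so they are known.
   If d < |I| - 1, bracketing j of the factors of the coefficient of t_n^j with x_n gives a product of
   symbols with the same leading term, which can be subtracted.
   If d = |I| - 1, the products (t_s - t_u) t_s^a t_u^b G are leading terms of Lie symbols, so modulo
   Lie symbols P is invariant under each transposition and thus equal to its average over the symmetric
   group. A symmetric admissible polynomial of degree 0 < d < |I| vanishes. *)

theory Submission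
  imports Defs "HOL-Library.Function_Algebras" "HOL-Computational_Algebra.Polynomial"
    "HOL-Combinatorics.Permutations"
begin

section \<open>Homogeneous polynomial functions\<close>

text \<open>The theorem alone does not support an induction: for k > 0 the coefficient of t_n^k in a
  Lie symbol has degree |I| - 1 - k in |I| - 1 variables, so it can only be a sum of products of k
  Lie symbols. This is why all degrees d < |I| are treated together. Polynomials are functions, and
  leading coefficients are recovered by finite differences with nodes 1, 0, -1, and so on. These
  nodes are the values that admissible points allow for a coordinate, so vanishing is inherited by
  the coefficients. Removing one variable fails for d = |I| - 1 because the coefficient of t_n^0
  then has as many variables as its degree, and the induction hypothesis is silent there. Removing
  two variables meets the same gap, but in a harmless form: a polynomial free of t_s and t_u is
  invariant under their transposition, and where the leading part is linear in them, t_s can be kept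
  as a dummy variable.\<close>

type_synonym 'k poly_fun = "(nat \<Rightarrow> 'k) \<Rightarrow> 'k"

definition cst :: "'k::field_char_0 \<Rightarrow> 'k poly_fun" where
  "cst c = (\<lambda>t. c)"

definition coord :: "nat \<Rightarrow> 'k::field_char_0 poly_fun" where
  "coord i = (\<lambda>t. t i)"

definition coord_sum :: "nat set \<Rightarrow> 'k::field_char_0 poly_fun" where
  "coord_sum I = (\<lambda>t. \<Sum>i\<in>I. t i)"

text \<open>Arguments of the inductive predicates below appear eta-expanded in their induction rules, so
  pointwise evaluation must not be a default simplification.\<close>

declare plus_fun_apply [simp del] times_fun_apply [simp del] zero_fun_apply [simp del]
  one_fun_apply [simp del] minus_apply [simp del]

lemma fun_minus_apply: "(f - g) x = f x - (g x :: 'k::field_char_0)"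
  by (rule minus_apply)

lemma fun_power_apply: "(f ^ n) x = (f x :: 'k::field_char_0) ^ n"
  by (induction n) (simp_all add: times_fun_apply one_fun_apply)

lemma fun_sum_apply: "(\<Sum>a\<in>A. f a) x = (\<Sum>a\<in>A. f a x :: 'k::field_char_0)"
  by (induction A rule: infinite_finite_induct) (simp_all add: plus_fun_apply zero_fun_apply)

lemma cst_apply: "cst c t = c"
  by (simp add: cst_def)

lemma coord_apply: "coord i t = t i"
  by (simp add: coord_def)

lemma coord_sum_apply: "coord_sum I t = (\<Sum>i\<in>I. t i)"
  by (simp add: coord_sum_def)

lemmas pointwise = plus_fun_apply times_fun_apply zero_fun_apply one_fun_apply fun_minus_apply
  fun_power_apply fun_sum_apply cst_apply coord_apply coord_sum_apply

text \<open>The zero function has every degree, so a vanishing coefficient can carry the truncated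
  degree \<open>d - k\<close> even when k exceeds d.\<close>

inductive hom_poly :: "nat set \<Rightarrow> nat \<Rightarrow> 'k::field_char_0 poly_fun \<Rightarrow> bool" for I where
  zero: "hom_poly I d 0"
| const: "hom_poly I 0 (cst c)"
| var: "i \<in> I \<Longrightarrow> hom_poly I d P \<Longrightarrow> hom_poly I (Suc d) (coord i * P)"
| add: "hom_poly I d P \<Longrightarrow> hom_poly I d Q \<Longrightarrow> hom_poly I d (P + Q)"

lemma hom_poly_cst: "hom_poly I d P \<Longrightarrow> hom_poly I d (cst c * P)"
proof (induction rule: hom_poly.induct)
  case (const c')
  have "cst c * cst c' = cst (c * c')" by (simp add: fun_eq_iff pointwise)
  then show ?case by (simp add: hom_poly.const)
next
  case (var i d P)
  then show ?case using hom_poly.var[of i I d "cst c * P"] by (simp add: mult.left_commute)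
qed (simp_all add: hom_poly.intros distrib_left)

lemma minus_eq_cst: "P - Q = P + cst (-1) * (Q :: 'k::field_char_0 poly_fun)"
  by (simp add: fun_eq_iff pointwise)

lemma hom_poly_diff: "hom_poly I d P \<Longrightarrow> hom_poly I d Q \<Longrightarrow> hom_poly I d (P - Q)"
  unfolding minus_eq_cst by (intro hom_poly.add hom_poly_cst)

lemma hom_poly_mult: "hom_poly I d P \<Longrightarrow> hom_poly I e Q \<Longrightarrow> hom_poly I (d + e) (P * Q)"
  by (induction rule: hom_poly.induct)
    (auto simp: hom_poly.intros distrib_right mult.assoc intro: hom_poly_cst)

lemma hom_poly_mono: "hom_poly I d P \<Longrightarrow> I \<subseteq> J \<Longrightarrow> hom_poly J d P"
  by (induction rule: hom_poly.induct) (auto intro: hom_poly.intros)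

lemma hom_poly_one: "hom_poly I 0 (1 :: 'k::field_char_0 poly_fun)"
proof -
  have "(1 :: 'k poly_fun) = cst 1" by (simp add: fun_eq_iff pointwise)
  then show ?thesis by (metis hom_poly.const)
qed

lemma hom_poly_coord: "i \<in> I \<Longrightarrow> hom_poly I (Suc 0) (coord i)"
  using hom_poly.var[OF _ hom_poly_one] by simp

lemma hom_poly_power_coord: "i \<in> I \<Longrightarrow> hom_poly I n (coord i ^ n)"
  by (induction n) (auto intro: hom_poly_one hom_poly.var)

lemma hom_poly_sum: "(\<And>a. a \<in> A \<Longrightarrow> hom_poly I d (P a)) \<Longrightarrow> hom_poly I d (\<Sum>a\<in>A. P a)"
  by (induction A rule: infinite_finite_induct) (auto intro: hom_poly.zero hom_poly.add)

lemma coord_sum_eq_sum: "coord_sum I = (\<Sum>i\<in>I. coord i)"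
  by (simp add: fun_eq_iff pointwise)

lemma hom_poly_coord_sum: "I \<subseteq> J \<Longrightarrow> hom_poly J (Suc 0) (coord_sum I)"
  unfolding coord_sum_eq_sum by (rule hom_poly_sum) (auto intro: hom_poly_coord)

lemma hom_poly_cong: "hom_poly I d P \<Longrightarrow> (\<And>i. i \<in> I \<Longrightarrow> t i = t' i) \<Longrightarrow> P t = P t'"
  by (induction rule: hom_poly.induct) (auto simp: pointwise)

lemma hom_poly_scaling: "hom_poly I d P \<Longrightarrow> P (\<lambda>i. c * t i) = c ^ d * P t"
  by (induction rule: hom_poly.induct) (auto simp: pointwise algebra_simps)

lemma hom_poly_0_const: "hom_poly I d P \<Longrightarrow> d = 0 \<Longrightarrow> \<exists>c. P = cst c"
proof (induction rule: hom_poly.induct)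
  case (zero d) show ?case by (rule exI[of _ 0]) (simp add: fun_eq_iff pointwise)
next
  case (add d P Q)
  then obtain c c' where "P = cst c" "Q = cst c'" by auto
  then show ?case by (intro exI[of _ "c + c'"]) (simp add: fun_eq_iff pointwise)
qed auto

text \<open>The polynomials over \<open>S \<union> I\<close> of total degree \<open>d\<close> whose degree in the variables from \<open>S\<close> is less
  than \<open>j\<close>; congruence modulo them compares leading terms.\<close>

inductive deg_below :: "nat set \<Rightarrow> nat set \<Rightarrow> nat \<Rightarrow> nat \<Rightarrow> 'k::field_char_0 poly_fun \<Rightarrow> bool" for S I where
  zero: "deg_below S I d j 0"
| base: "hom_poly I d P \<Longrightarrow> deg_below S I d (Suc j) P"
| var: "x \<in> S \<Longrightarrow> deg_below S I d j P \<Longrightarrow> deg_below S I (Suc d) (Suc j) (coord x * P)"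
| add: "deg_below S I d j P \<Longrightarrow> deg_below S I d j Q \<Longrightarrow> deg_below S I d j (P + Q)"

lemma deg_below_mono:
  "deg_below S I d j P \<Longrightarrow> j \<le> j' \<Longrightarrow> S \<subseteq> S' \<Longrightarrow> I \<subseteq> I' \<Longrightarrow> deg_below S' I' d j' P"
proof (induction arbitrary: j' rule: deg_below.induct)
  case (base d P j)
  then obtain k where "j' = Suc k" by (cases j') auto
  then show ?case using base by (auto intro: deg_below.base hom_poly_mono)
next
  case (var x d j P)
  then obtain k where "j' = Suc k" by (cases j') auto
  then show ?case using var by (auto intro: deg_below.var)
qed (auto intro: deg_below.intros)

lemma deg_below_0: "deg_below S I d j P \<Longrightarrow> j = 0 \<Longrightarrow> P = 0"
  by (induction rule: deg_below.induct) auto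

lemma deg_below_mult_hom: "deg_below S I e j Q \<Longrightarrow> hom_poly I d P \<Longrightarrow> deg_below S I (d + e) j (P * Q)"
proof (induction rule: deg_below.induct)
  case (var x e j Q)
  then show ?case using deg_below.var[of x S I "d + e" j "P * Q"] by (simp add: mult.left_commute)
qed (auto simp: distrib_left intro: deg_below.intros hom_poly_mult)

text \<open>The bounds are strict: degree below j times degree at most k is again below j +
  k.\<close>

lemma deg_below_mult:
  "deg_below S I d j P \<Longrightarrow> deg_below S I e (Suc k) Q \<Longrightarrow> deg_below S I (d + e) (j + k) (P * Q)"
proof (induction rule: deg_below.induct)
  case (base d P j)
  then have "deg_below S I (d + e) (Suc k) (P * Q)" by (intro deg_below_mult_hom)
  then show ?case by (rule deg_below_mono) auto
next
  case (var x d j P)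
  then show ?case using deg_below.var[of x S I "d + e" "j + k" "P * Q"] by (simp add: mult.assoc)
qed (auto simp: distrib_right intro: deg_below.intros)

lemma deg_below_cst: "deg_below S I d j P \<Longrightarrow> deg_below S I d j (cst c * P)"
  using deg_below_mult_hom[OF _ hom_poly.const] by fastforce

lemma deg_below_diff: "deg_below S I d j P \<Longrightarrow> deg_below S I d j Q \<Longrightarrow> deg_below S I d j (P - Q)"
  unfolding minus_eq_cst by (intro deg_below.add deg_below_cst)

lemma deg_below_power: "x \<in> S \<Longrightarrow> deg_below S I n (Suc n) (coord x ^ n)"
  by (induction n) (auto intro: deg_below.var deg_below.base hom_poly_one)

lemma deg_below_monomial:
  assumes "x \<in> S" "hom_poly I d P"
  shows "deg_below S I (d + n) (Suc n) (coord x ^ n * P)"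
  using deg_below_mult_hom[OF deg_below_power assms(2), OF assms(1), of n] by (simp add: mult.commute)

lemma deg_below_sum: "(\<And>a. a \<in> A \<Longrightarrow> deg_below S I d j (P a)) \<Longrightarrow> deg_below S I d j (\<Sum>a\<in>A. P a)"
  by (induction A rule: infinite_finite_induct) (auto intro: deg_below.zero deg_below.add)

lemma deg_below_eqI: "deg_below S I d j P \<Longrightarrow> d = d' \<Longrightarrow> j = j' \<Longrightarrow> P = Q \<Longrightarrow> deg_below S I d' j' Q"
  by simp

text \<open>Every descent on the degree in \<open>S\<close> starts here, with the total degree as
  the bound.\<close>

lemma hom_poly_deg_below: "hom_poly (S \<union> I) d P \<Longrightarrow> deg_below S I d (Suc d) P"
proof (induction rule: hom_poly.induct)
  case (var i d P)
  show ?case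
  proof (cases "i \<in> S")
    case True then show ?thesis using var by (auto intro: deg_below.var)
  next
    case False
    then have "i \<in> I" using var by auto
    then have "deg_below S I (Suc 0 + d) (Suc d) (coord i * P)"
      by (intro deg_below_mult_hom var hom_poly_coord)
    then show ?thesis by (rule deg_below_mono[THEN deg_below_eqI]) auto
  qed
qed (auto intro: deg_below.intros hom_poly.intros)

text \<open>Coefficients are not part of the data, so the leading one is built along the rules that
  generate P. The clause for d < k makes up for the truncation in \<open>d - k\<close>.\<close>

lemma top_coeff_one:
  assumes "deg_below {n} I d j P" "j = Suc k"
  shows "\<exists>q. hom_poly I (d - k) q \<and> (d < k \<longrightarrow> q = 0) \<and> deg_below {n} I d k (P - coord n ^ k * q)"
  using assms
proof (induction arbitrary: k rule: deg_below.induct)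
  case (zero d j)
  show ?case by (rule exI[of _ 0]) (auto intro: hom_poly.zero deg_below.zero)
next
  case (base d P j)
  show ?case
  proof (cases k)
    case 0
    then show ?thesis using base by (intro exI[of _ P]) (auto intro: deg_below.zero)
  next
    case (Suc k')
    then show ?thesis using base by (intro exI[of _ 0]) (auto intro: hom_poly.zero deg_below.base)
  qed
next
  case (var x d j P)
  then have j: "j = k" "x = n" by auto
  show ?case
  proof (cases k)
    case 0
    then have "P = 0" using var j deg_below_0 by blast
    then show ?thesis by (intro exI[of _ 0]) (auto intro: hom_poly.zero deg_below.zero)
  next
    case (Suc k')
    with var.IH[of k'] j obtain q where q: "hom_poly I (d - k') q" "d < k' \<longrightarrow> q = 0"
      "deg_below {n} I d k' (P - coord n ^ k' * q)" by auto
    have "deg_below {n} I (Suc d) (Suc k') (coord n * (P - coord n ^ k' * q))"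
      using q by (intro deg_below.var) auto
    then have "deg_below {n} I (Suc d) k (coord x * P - coord n ^ k * q)"
      by (rule deg_below_eqI) (auto simp: Suc j algebra_simps)
    then show ?thesis using q Suc by (intro exI[of _ q]) auto
  qed
next
  case (add d j P Q)
  then obtain p q where p: "hom_poly I (d - k) p" "d < k \<longrightarrow> p = 0"
      "deg_below {n} I d k (P - coord n ^ k * p)"
    and q: "hom_poly I (d - k) q" "d < k \<longrightarrow> q = 0" "deg_below {n} I d k (Q - coord n ^ k * q)"
    by blast
  have "deg_below {n} I d k (P + Q - coord n ^ k * (p + q))"
    by (rule deg_below_eqI[OF deg_below.add[OF p(3) q(3)]]) (simp_all add: algebra_simps)
  then show ?case using p q by (intro exI[of _ "p + q"] conjI hom_poly.add) auto
qed

text \<open>With two distinguished variables the leading part is a binary form of degree k in them,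
  whose coefficients \<open>q a\<close> are polynomials in the other variables.\<close>

lemma top_coeff_two:
  assumes "deg_below {s, u} I d j P" "j = Suc k"
  shows "\<exists>q. (\<forall>a. hom_poly I (d - k) (q a) \<and> (d < k \<longrightarrow> q a = 0)) \<and>
    deg_below {s, u} I d k (P - (\<Sum>a\<le>k. coord s ^ a * coord u ^ (k - a) * q a))"
  using assms
proof (induction arbitrary: k rule: deg_below.induct)
  case (zero d j)
  show ?case by (rule exI[of _ "\<lambda>_. 0"]) (auto intro: hom_poly.zero deg_below.zero)
next
  case (base d P j)
  show ?case
  proof (cases k)
    case 0
    then show ?thesis using base by (intro exI[of _ "\<lambda>_. P"]) (auto intro: deg_below.zero)
  next
    case (Suc k')
    then show ?thesis using base by (intro exI[of _ "\<lambda>_. 0"]) (auto intro: hom_poly.zero deg_below.base)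
  qed
next
  case (var x d j P)
  then have j: "j = k" by auto
  show ?case
  proof (cases k)
    case 0
    then have "P = 0" using var j deg_below_0 by blast
    then show ?thesis by (intro exI[of _ "\<lambda>_. 0"]) (auto intro: hom_poly.zero deg_below.zero)
  next
    case (Suc k')
    with var.IH[of k'] j obtain q where q: "\<And>a. hom_poly I (d - k') (q a)" "\<And>a. d < k' \<Longrightarrow> q a = 0"
      "deg_below {s, u} I d k' (P - (\<Sum>a\<le>k'. coord s ^ a * coord u ^ (k' - a) * q a))" by auto
    let ?P = "P - (\<Sum>a\<le>k'. coord s ^ a * coord u ^ (k' - a) * q a)"
    have below: "deg_below {s, u} I (Suc d) (Suc k') (coord x * ?P)"
      using q var by (intro deg_below.var) auto
    \<comment> \<open>A factor t_s shifts the index a by one. A factor t_u only raises the exponent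
      of t_u, so the indices stay and the new slot a = k is empty.\<close>
    define r where "r = (if x = s then (\<lambda>a. case a of 0 \<Rightarrow> 0 | Suc b \<Rightarrow> q b) else (\<lambda>a. if a = k then 0 else q a))"
    have "(\<Sum>a\<le>k. coord s ^ a * coord u ^ (k - a) * r a)
        = coord x * (\<Sum>a\<le>k'. coord s ^ a * coord u ^ (k' - a) * q a)"
    proof (cases "x = s")
      case True
      show ?thesis unfolding Suc by (subst sum.atMost_Suc_shift)
          (simp add: r_def True sum_distrib_left mult.assoc)
    next
      case False
      then have x: "x = u" using var by auto
      have "coord s ^ a * coord u ^ (Suc k' - a) * q a = coord u * (coord s ^ a * coord u ^ (k' - a) * q a)"
        if "a \<le> k'" for a
        using that by (simp add: Suc_diff_le ac_simps)
      then show ?thesis unfolding Suc using False x by (simp add: r_def sum_distrib_left Suc)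
    qed
    then have "deg_below {s, u} I (Suc d) k (coord x * P - (\<Sum>a\<le>k. coord s ^ a * coord u ^ (k - a) * r a))"
      using below by (elim deg_below_eqI) (simp_all add: Suc algebra_simps)
    moreover have "hom_poly I (Suc d - k) (r a) \<and> (Suc d < k \<longrightarrow> r a = 0)" for a
      using q Suc by (auto simp: r_def hom_poly.zero split: nat.split)
    ultimately show ?thesis by blast
  qed
next
  case (add d j P Q)
  then obtain p q where p: "\<And>a. hom_poly I (d - k) (p a)" "\<And>a. d < k \<Longrightarrow> p a = 0"
      "deg_below {s, u} I d k (P - (\<Sum>a\<le>k. coord s ^ a * coord u ^ (k - a) * p a))"
    and q: "\<And>a. hom_poly I (d - k) (q a)" "\<And>a. d < k \<Longrightarrow> q a = 0"
      "deg_below {s, u} I d k (Q - (\<Sum>a\<le>k. coord s ^ a * coord u ^ (k - a) * q a))"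
    by blast
  have "deg_below {s, u} I d k (P + Q - (\<Sum>a\<le>k. coord s ^ a * coord u ^ (k - a) * (p a + q a)))"
    by (rule deg_below_eqI[OF deg_below.add[OF p(3) q(3)]]) (simp_all add: algebra_simps sum.distrib)
  then show ?case using p q
    by (intro exI[of _ "\<lambda>a. p a + q a"] conjI allI hom_poly.add) auto
qed

section \<open>Finite differences\<close>

lemma power_diff_pred:
  fixes y :: "'k::field_char_0"
  shows "\<exists>c. c n = of_nat (Suc n) \<and> (\<forall>y. y ^ Suc n - (y - 1) ^ Suc n = (\<Sum>i\<le>n. c i * y ^ i :: 'k))"
proof -
  define c where "c i = - (of_nat (Suc n choose i) * (-1) ^ (Suc n - i) :: 'k)" for i
  have "y ^ Suc n - (y - 1) ^ Suc n = (\<Sum>i\<le>n. c i * y ^ i)" for y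
  proof -
    have "(y + (-1)) ^ Suc n = (\<Sum>i\<le>Suc n. of_nat (Suc n choose i) * y ^ i * (-1) ^ (Suc n - i))"
      by (rule binomial_ring)
    also have "\<dots> = (\<Sum>i\<le>n. of_nat (Suc n choose i) * y ^ i * (-1) ^ (Suc n - i)) + y ^ Suc n"
      by simp
    finally show ?thesis
      by (simp add: c_def sum_negf algebra_simps)
  qed
  moreover have "c n = of_nat (Suc n)" by (simp add: c_def)
  ultimately show ?thesis by blast
qed

text \<open>These are the weights of the a-th backward difference divided by a!. The result does not
  depend on the base point x, and the induction relies on this: differencing once more cancels all
  powers up to a.\<close>

lemma difference_weights:
  "\<exists>w :: nat \<Rightarrow> 'k::field_char_0. \<forall>x. \<forall>i\<le>a. (\<Sum>k\<le>a. w k * (x - of_nat k) ^ i) = (if i = a then 1 else 0)"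
proof (induction a)
  case 0 show ?case by (rule exI[of _ "\<lambda>_. 1"]) auto
next
  case (Suc a)
  then obtain w :: "nat \<Rightarrow> 'k"
    where w: "\<And>x i. i \<le> a \<Longrightarrow> (\<Sum>k\<le>a. w k * (x - of_nat k) ^ i) = (if i = a then 1 else 0)" by blast
  \<comment> \<open>The difference of w and its shift by one node, divided by the factor a + 1 that
    appears when x^(a+1) is differenced.\<close>
  define v where "v k = ((if k \<le> a then w k else 0) - (case k of 0 \<Rightarrow> 0 | Suc l \<Rightarrow> w l)) / of_nat (Suc a)" for k
  have v: "(\<Sum>k\<le>Suc a. v k * (x - of_nat k) ^ i)
      = (\<Sum>k\<le>a. w k * ((x - of_nat k) ^ i - (x - of_nat k - 1) ^ i)) / of_nat (Suc a)" for x i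
  proof -
    have "(\<Sum>k\<le>Suc a. (if k \<le> a then w k else 0) * (x - of_nat k) ^ i) = (\<Sum>k\<le>a. w k * (x - of_nat k) ^ i)"
      by simp
    moreover have "(\<Sum>k\<le>Suc a. (case k of 0 \<Rightarrow> 0 | Suc l \<Rightarrow> w l) * (x - of_nat k) ^ i)
        = (\<Sum>k\<le>a. w k * (x - of_nat k - 1) ^ i)"
      by (subst sum.atMost_Suc_shift) (simp add: algebra_simps)
    ultimately show ?thesis
      by (simp add: v_def sum_subtractf algebra_simps diff_divide_distrib flip: sum_divide_distrib)
  qed
  have "(\<Sum>k\<le>Suc a. v k * (x - of_nat k) ^ i) = (if i = Suc a then 1 else 0)" if i: "i \<le> Suc a" for x i
  proof (cases "i \<le> a")
    case True
    have "(\<Sum>k\<le>a. w k * ((x - of_nat k) ^ i - (x - of_nat k - 1) ^ i))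
      = (\<Sum>k\<le>a. w k * (x - of_nat k) ^ i) - (\<Sum>k\<le>a. w k * ((x - 1) - of_nat k) ^ i)"
      by (simp add: algebra_simps sum_subtractf)
    also have "\<dots> = 0" unfolding w[OF True] by simp
    finally show ?thesis unfolding v using True by simp
  next
    case False
    then have i: "i = Suc a" using that by simp
    obtain c :: "nat \<Rightarrow> 'k" where c: "c a = of_nat (Suc a)"
      "\<And>y. y ^ Suc a - (y - 1) ^ Suc a = (\<Sum>i\<le>a. c i * y ^ i)"
      using power_diff_pred[of a] by blast
    have "(\<Sum>k\<le>a. w k * ((x - of_nat k) ^ Suc a - (x - of_nat k - 1) ^ Suc a))
      = (\<Sum>k\<le>a. \<Sum>i\<le>a. c i * (w k * (x - of_nat k) ^ i))"
      unfolding c(2) by (simp add: sum_distrib_left ac_simps)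
    also have "\<dots> = (\<Sum>i\<le>a. c i * (\<Sum>k\<le>a. w k * (x - of_nat k) ^ i))"
      by (subst sum.swap) (simp add: sum_distrib_left)
    also have "\<dots> = (\<Sum>i\<le>a. c i * (if i = a then 1 else 0))"
      by (rule sum.cong) (auto simp: w)
    also have "\<dots> = of_nat (Suc a)" by (simp add: c(1) if_distrib sum.delta cong: if_cong)
    finally show ?thesis unfolding v i using of_nat_neq_0[of a, where 'a='k] by simp
  qed
  then show ?case by blast
qed

section \<open>Admissible polynomials\<close>

text \<open>The threshold is a pigeonhole bound: if I is split into card I - d blocks and the
  coordinate sum exceeds that number, some block has sum at least 2, and a Lie symbol on that block
  vanishes. It is written additively to avoid subtraction; for d = card I - 1 it reads: sum at least
  2, as in V_n.\<close>

definition admissible :: "nat set \<Rightarrow> nat \<Rightarrow> 'k::field_char_0 poly_fun \<Rightarrow> bool" where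
  "admissible I d P \<longleftrightarrow> hom_poly I d P \<and> (\<forall>a :: nat \<Rightarrow> int.
     (\<forall>i\<in>I. a i \<le> 1) \<longrightarrow> int (card I) + 1 \<le> sum a I + int d \<longrightarrow> P (\<lambda>i. of_int (a i)) = 0)"

lemma admissible_hom_poly: "admissible I d P \<Longrightarrow> hom_poly I d P"
  by (simp add: admissible_def)

lemma admissible_eval:
  "admissible I d P \<Longrightarrow> (\<And>i. i \<in> I \<Longrightarrow> a i \<le> 1) \<Longrightarrow> int (card I) + 1 \<le> sum a I + int d
    \<Longrightarrow> P (\<lambda>i. of_int (a i)) = 0"
  by (auto simp: admissible_def)

lemma admissible_zero: "admissible I d 0"
  by (auto simp: admissible_def hom_poly.zero pointwise)

lemma admissible_add: "admissible I d P \<Longrightarrow> admissible I d Q \<Longrightarrow> admissible I d (P + Q)"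
  by (auto simp: admissible_def hom_poly.add pointwise)

lemma admissible_cst: "admissible I d P \<Longrightarrow> admissible I d (cst c * P)"
  by (auto simp: admissible_def hom_poly_cst pointwise)

lemma admissible_diff: "admissible I d P \<Longrightarrow> admissible I d Q \<Longrightarrow> admissible I d (P - Q)"
  unfolding minus_eq_cst by (intro admissible_add admissible_cst)

text \<open>If both factors missed their thresholds, then sum a I + d <= card I and sum a J + e <=
  card J, and adding these contradicts the threshold of the product.\<close>

lemma admissible_mult:
  assumes "admissible I d P" "admissible J e Q" "finite I" "finite J" "I \<inter> J = {}"
  shows "admissible (I \<union> J) (d + e) (P * Q)"
  unfolding admissible_def
proof (intro conjI allI impI)
  show "hom_poly (I \<union> J) (d + e) (P * Q)"
    using assms by (intro hom_poly_mult) (auto intro: hom_poly_mono admissible_hom_poly)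
next
  fix a :: "nat \<Rightarrow> int"
  assume a: "\<forall>i\<in>I \<union> J. a i \<le> 1" and "int (card (I \<union> J)) + 1 \<le> sum a (I \<union> J) + int (d + e)"
  then have "int (card I) + int (card J) + 1 \<le> sum a I + sum a J + int d + int e"
    using assms by (simp add: card_Un_disjoint sum.union_disjoint)
  then consider "int (card I) + 1 \<le> sum a I + int d" | "int (card J) + 1 \<le> sum a J + int e"
    by linarith
  then show "(P * Q) (\<lambda>i. of_int (a i)) = 0"
    using a admissible_eval[OF assms(1), of a] admissible_eval[OF assms(2), of a]
    by cases (simp_all add: pointwise)
qed

text \<open>If the total is at least 2 and neither block sum reaches 2, both block sums are 1 and
  the last factor vanishes.\<close>

lemma admissible_bracket:
  assumes "admissible I (card I - 1) P" "admissible J (card J - 1) Q" "finite I" "finite J"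
    "I \<inter> J = {}" "I \<noteq> {}" "J \<noteq> {}"
  shows "admissible (I \<union> J) (card (I \<union> J) - 1) (P * Q * (coord_sum J - coord_sum I))"
  unfolding admissible_def
proof (intro conjI allI impI)
  have c: "card I > 0" "card J > 0" "card (I \<union> J) = card I + card J"
    using assms by (auto simp: card_gt_0_iff card_Un_disjoint)
  have "hom_poly (I \<union> J) (card I - 1 + (card J - 1) + Suc 0) (P * Q * (coord_sum J - coord_sum I))"
    using assms by (intro hom_poly_mult hom_poly_diff hom_poly_coord_sum)
      (auto intro: hom_poly_mono admissible_hom_poly)
  moreover have "card I - 1 + (card J - 1) + Suc 0 = card (I \<union> J) - 1" using c by simp
  ultimately show "hom_poly (I \<union> J) (card (I \<union> J) - 1) (P * Q * (coord_sum J - coord_sum I))"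
    by simp
  fix a :: "nat \<Rightarrow> int"
  assume a: "\<forall>i\<in>I \<union> J. a i \<le> 1"
    and "int (card (I \<union> J)) + 1 \<le> sum a (I \<union> J) + int (card (I \<union> J) - 1)"
  then have "2 \<le> sum a I + sum a J"
    using assms c by (simp add: sum.union_disjoint of_nat_diff)
  then consider "2 \<le> sum a I" | "2 \<le> sum a J" | "sum a I = sum a J" by linarith
  then show "(P * Q * (coord_sum J - coord_sum I)) (\<lambda>i. of_int (a i)) = 0"
  proof cases
    case 1
    then show ?thesis using admissible_eval[OF assms(1), of a] a c by (simp add: pointwise of_nat_diff)
  next
    case 2
    then show ?thesis using admissible_eval[OF assms(2), of a] a c by (simp add: pointwise of_nat_diff)
  next
    case 3
    have "(\<Sum>i\<in>I. of_int (a i)) = (\<Sum>i\<in>J. of_int (a i) :: 'a)" using 3 by (metis of_int_sum)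
    then show ?thesis by (simp add: pointwise)
  qed
qed

text \<open>Weighted sums of the values of \<open>P\<close> at \<open>t\<^sub>n = 1, 0, -1, \<dots>, 1 - k\<close> isolate the coefficient
  of \<open>t\<^sub>n\<^sup>k\<close>; this is what makes the admissible points hereditary.\<close>

lemma difference_kills_lower:
  assumes w: "\<And>i. i \<le> k \<Longrightarrow> (\<Sum>l\<le>k. w l * (1 - of_nat l) ^ i) = (if i = k then 1 else 0)"
    and "n \<notin> I"
  shows "deg_below {n} I d j P \<Longrightarrow> i + j \<le> k \<Longrightarrow>
    (\<Sum>l\<le>k. w l * ((1 - of_nat l) ^ i * P (t(n := 1 - of_nat l)))) = 0"
proof (induction arbitrary: i rule: deg_below.induct)
  case (base d P j)
  have "P (t(n := x)) = P t" for x
    using hom_poly_cong[OF base(1)] \<open>n \<notin> I\<close> by (metis fun_upd_other)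
  then have "(\<Sum>l\<le>k. w l * ((1 - of_nat l) ^ i * P (t(n := 1 - of_nat l))))
     = (\<Sum>l\<le>k. w l * (1 - of_nat l) ^ i) * P t" by (simp add: sum_distrib_right mult.assoc)
  then show ?case using base w[of i] by (simp add: fun_upd_def)
next
  case (var x d j P)
  \<comment> \<open>The factor t_n removed from P is absorbed into the power of the node; hence the
    general exponent i.\<close>
  show ?case using var.IH[of "Suc i"] var by (simp add: pointwise mult_ac)
qed (simp_all add: pointwise distrib_left sum.distrib)

text \<open>A formula for q by values of P alone, through which both vanishing and symmetry pass
  from P to q.\<close>

lemma top_coeff_eq_difference:
  assumes w: "\<And>i. i \<le> k \<Longrightarrow> (\<Sum>l\<le>k. w l * (1 - of_nat l) ^ i) = (if i = k then 1 else 0)"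
    and "n \<notin> I" and q: "hom_poly I e q" and low: "deg_below {n} I d k (P - coord n ^ k * q)"
  shows "q t = (\<Sum>l\<le>k. w l * P (t(n := 1 - of_nat l)))"
proof -
  have "q (t(n := x)) = q t" for x
    by (rule hom_poly_cong[OF q]) (use assms in auto)
  then have "0 = (\<Sum>l\<le>k. w l * (P (t(n := 1 - of_nat l)) - (1 - of_nat l) ^ k * q t))"
    using difference_kills_lower[OF w assms(2) low, of 0 t] by (simp add: pointwise)
  also have "\<dots> = (\<Sum>l\<le>k. w l * P (t(n := 1 - of_nat l))) - (\<Sum>l\<le>k. w l * (1 - of_nat l) ^ k) * q t"
    by (simp add: sum_distrib_right right_diff_distrib sum_subtractf mult.assoc)
  finally show ?thesis using w[of k] by simp
qed

text \<open>At t_n = 1 - l the value 1 pays for the additional variable in the cardinality, and the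
  loss l <= k is paid for by the difference between the degrees d and d - k.\<close>

lemma admissible_top_one:
  assumes "admissible (insert n I) d P" "finite I" "n \<notin> I" "hom_poly I (d - k) q" "k \<le> d"
    and low: "deg_below {n} I d k (P - coord n ^ k * q)"
  shows "admissible I (d - k) q"
  unfolding admissible_def
proof (intro conjI allI impI)
  fix a :: "nat \<Rightarrow> int"
  assume a: "\<forall>i\<in>I. a i \<le> 1" and sum: "int (card I) + 1 \<le> sum a I + int (d - k)"
  obtain w :: "nat \<Rightarrow> 'a"
    where w: "\<And>i. i \<le> k \<Longrightarrow> (\<Sum>l\<le>k. w l * (1 - of_nat l) ^ i) = (if i = k then 1 else 0)"
    using difference_weights by blast
  let ?t = "\<lambda>i. of_int (a i) :: 'a"
  have "P (?t(n := 1 - of_nat l)) = 0" if "l \<le> k" for l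
  proof -
    have "?t(n := 1 - of_nat l) = (\<lambda>i. of_int ((a(n := 1 - int l)) i))" by (auto simp: fun_eq_iff)
    moreover have "sum (a(n := 1 - int l)) (insert n I) = 1 - int l + sum a I"
    proof -
      have "sum (a(n := 1 - int l)) I = sum a I" using assms by (intro sum.cong) auto
      then show ?thesis using assms by simp
    qed
    moreover have "P (\<lambda>i. of_int ((a(n := 1 - int l)) i)) = 0"
      by (rule admissible_eval[OF assms(1)]) (use a sum that assms calculation in \<open>auto simp: of_nat_diff\<close>)
    ultimately show ?thesis by (simp only:)
  qed
  then show "q ?t = 0"
    using top_coeff_eq_difference[OF w assms(3,4) low] by simp
qed (fact assms(4))

lemma sum_sum_separate:
  fixes v w f g :: "nat \<Rightarrow> 'k::field_char_0"
  shows "(\<Sum>l\<in>A. \<Sum>m\<in>B. v l * w m * (f l * g m * c)) = (\<Sum>l\<in>A. v l * f l) * (\<Sum>m\<in>B. w m * g m) * c"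
  by (subst sum_product) (simp add: sum_distrib_left sum_distrib_right mult_ac)

text \<open>A term of degree below a + b in t_s and t_u has degree below a in t_s or below b in t_u,
  so one of the two difference operators annihilates it.\<close>

lemma difference_kills_lower_two:
  assumes v: "\<And>i. i \<le> a \<Longrightarrow> (\<Sum>l\<le>a. v l * (1 - of_nat l) ^ i) = (if i = a then 1 else 0)"
    and w: "\<And>i. i \<le> b \<Longrightarrow> (\<Sum>l\<le>b. w l * (1 - of_nat l) ^ i) = (if i = b then 1 else 0)"
    and "s \<notin> I" "u \<notin> I" "s \<noteq> u"
  shows "deg_below {s, u} I d j P \<Longrightarrow> i + i' + j \<le> a + b \<Longrightarrow>
    (\<Sum>l\<le>a. \<Sum>m\<le>b. v l * w m * ((1 - of_nat l) ^ i * (1 - of_nat m) ^ i'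
      * P (t(s := 1 - of_nat l, u := 1 - of_nat m)))) = 0"
proof (induction arbitrary: i i' rule: deg_below.induct)
  case (base d P j)
  have "P (t(s := x, u := y)) = P t" for x y
    by (rule hom_poly_cong[OF base(1)]) (use assms in auto)
  then have "(\<Sum>l\<le>a. \<Sum>m\<le>b. v l * w m * ((1 - of_nat l) ^ i * (1 - of_nat m) ^ i'
      * P (t(s := 1 - of_nat l, u := 1 - of_nat m))))
     = (\<Sum>l\<le>a. v l * (1 - of_nat l) ^ i) * (\<Sum>m\<le>b. w m * (1 - of_nat m) ^ i') * P t"
    by (simp only: sum_sum_separate)
  moreover have "i < a \<or> i' < b" using base by auto
  ultimately show ?case using v[of i] w[of i'] by (auto simp: fun_upd_def)
next
  case (var x d j P)
  show ?case
  proof (cases "x = s")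
    case True
    then show ?thesis using var.IH[of "Suc i" i'] var \<open>s \<noteq> u\<close> by (simp add: pointwise mult_ac)
  next
    case False
    then have "x = u" using var by auto
    then show ?thesis using var.IH[of i "Suc i'"] var \<open>s \<noteq> u\<close> by (simp add: pointwise mult_ac)
  qed
qed (simp_all add: pointwise distrib_left sum.distrib)

text \<open>Differences of order a in t_s and order k - a in t_u single out \<open>q a\<close> in
  the leading binary form; the nodes are admissible for the same reason as with one
  variable.\<close>

lemma admissible_top_two:
  assumes "admissible (insert s (insert u I)) d P" "finite I" "s \<notin> I" "u \<notin> I" "s \<noteq> u"
    and q: "\<And>a. hom_poly I (d - k) (q a)" and "k \<le> d"
    and low: "deg_below {s, u} I d k (P - (\<Sum>a\<le>k. coord s ^ a * coord u ^ (k - a) * q a))"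
    and "a \<le> k"
  shows "admissible I (d - k) (q a)"
  unfolding admissible_def
proof (intro conjI allI impI)
  fix z :: "nat \<Rightarrow> int"
  assume z: "\<forall>i\<in>I. z i \<le> 1" and sum: "int (card I) + 1 \<le> sum z I + int (d - k)"
  let ?b = "k - a"
  obtain v :: "nat \<Rightarrow> 'a"
    where v: "\<And>i. i \<le> a \<Longrightarrow> (\<Sum>l\<le>a. v l * (1 - of_nat l) ^ i) = (if i = a then 1 else 0)"
    using difference_weights by blast
  obtain w :: "nat \<Rightarrow> 'a"
    where w: "\<And>i. i \<le> ?b \<Longrightarrow> (\<Sum>l\<le>?b. w l * (1 - of_nat l) ^ i) = (if i = ?b then 1 else 0)"
    using difference_weights by blast
  let ?t = "\<lambda>i. of_int (z i) :: 'a"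
  let ?p = "\<lambda>l m. ?t(s := 1 - of_nat l, u := 1 - of_nat m)"
  have P0: "P (?p l m) = 0" if "l \<le> a" "m \<le> ?b" for l m
  proof -
    let ?z = "z(s := 1 - int l, u := 1 - int m)"
    have "?p l m = (\<lambda>i. of_int (?z i))" by (auto simp: fun_eq_iff)
    moreover have "sum ?z (insert s (insert u I)) = 1 - int l + (1 - int m) + sum z I"
    proof -
      have "sum ?z I = sum z I" using assms by (intro sum.cong) auto
      then show ?thesis using assms by simp
    qed
    moreover have "P (\<lambda>i. of_int (?z i)) = 0"
      by (rule admissible_eval[OF assms(1)]) (use z sum that assms calculation in \<open>auto simp: of_nat_diff\<close>)
    ultimately show ?thesis by (simp only:)
  qed
  have q': "q a' (?p l m) = q a' ?t" for a' l m
    by (rule hom_poly_cong[OF q]) (use assms in auto)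
  let ?S = "\<Sum>a\<le>k. coord s ^ a * coord u ^ (k - a) * q a"
  have "(P - ?S) (?p l m) = - (\<Sum>a'\<le>k. (1 - of_nat l) ^ a' * (1 - of_nat m) ^ (k - a') * q a' ?t)"
    if "l \<le> a" "m \<le> ?b" for l m
    using P0[OF that] \<open>s \<noteq> u\<close> by (simp add: pointwise q')
  then have "0 = (\<Sum>l\<le>a. \<Sum>m\<le>?b. v l * w m *
      - (\<Sum>a'\<le>k. (1 - of_nat l) ^ a' * (1 - of_nat m) ^ (k - a') * q a' ?t))"
    using difference_kills_lower_two[OF v w assms(3-5) low, of 0 0 ?t] \<open>a \<le> k\<close> by simp
  also have "\<dots> = - (\<Sum>a'\<le>k. (\<Sum>l\<le>a. v l * (1 - of_nat l) ^ a')
      * (\<Sum>m\<le>?b. w m * (1 - of_nat m) ^ (k - a')) * q a' ?t)"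
  proof -
    have "(\<Sum>l\<le>a. \<Sum>m\<le>?b. v l * w m * (\<Sum>a'\<le>k. (1 - of_nat l) ^ a' * (1 - of_nat m) ^ (k - a') * q a' ?t))
      = (\<Sum>l\<le>a. \<Sum>m\<le>?b. \<Sum>a'\<le>k. v l * w m * ((1 - of_nat l) ^ a' * (1 - of_nat m) ^ (k - a') * q a' ?t))"
      by (simp only: sum_distrib_left)
    also have "\<dots> = (\<Sum>a'\<le>k. \<Sum>l\<le>a. \<Sum>m\<le>?b. v l * w m * ((1 - of_nat l) ^ a' * (1 - of_nat m) ^ (k - a') * q a' ?t))"
      by (subst sum.swap[of _ "{..k}"], subst sum.swap[of _ "{..k}" "{..a}"]) (rule refl)
    finally show ?thesis by (simp add: sum_sum_separate sum_negf)
  qed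
  also have "(\<Sum>a'\<le>k. (\<Sum>l\<le>a. v l * (1 - of_nat l) ^ a')
      * (\<Sum>m\<le>?b. w m * (1 - of_nat m) ^ (k - a')) * q a' ?t) = (\<Sum>a'\<le>k. if a' = a then q a ?t else 0)"
  proof (rule sum.cong)
    fix a' assume "a' \<in> {..k}"
    \<comment> \<open>Both pairs of exponents add up to k, so for a' different from a one exponent
      lies below the order of its difference, and that factor is 0.\<close>
    then consider "a' < a" | "a' = a" | "a < a'" "k - a' < ?b" by force
    then show "(\<Sum>l\<le>a. v l * (1 - of_nat l) ^ a') * (\<Sum>m\<le>?b. w m * (1 - of_nat m) ^ (k - a')) * q a' ?t
      = (if a' = a then q a ?t else 0)"
      by cases (use v[of a'] w[of "k - a'"] in auto)
  qed simp
  also have "\<dots> = q a ?t" using \<open>a \<le> k\<close> by simp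
  finally show "q a ?t = 0" by simp
qed (fact q)

section \<open>Permuting variables\<close>

definition permute_vars :: "(nat \<Rightarrow> nat) \<Rightarrow> 'k poly_fun \<Rightarrow> 'k::field_char_0 poly_fun" where
  "permute_vars p P = (\<lambda>t. P (t \<circ> p))"

lemma permute_vars_ring:
  "permute_vars p 0 = 0" "permute_vars p (cst c) = cst c"
  "permute_vars p (P + Q) = permute_vars p P + permute_vars p Q"
  "permute_vars p (P - Q) = permute_vars p P - permute_vars p Q"
  "permute_vars p (P * Q) = permute_vars p P * permute_vars p Q"
  "permute_vars p (P ^ n) = permute_vars p P ^ n"
  "permute_vars p (\<Sum>a\<in>A. F a) = (\<Sum>a\<in>A. permute_vars p (F a))"
  "permute_vars p (coord i) = coord (p i)"
  by (simp_all add: permute_vars_def fun_eq_iff pointwise)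

lemma permute_vars_id: "permute_vars id P = P"
  by (simp add: permute_vars_def)

lemma permute_vars_comp: "permute_vars p (permute_vars q P) = permute_vars (p \<circ> q) P"
  by (simp add: permute_vars_def comp_assoc)

lemma hom_poly_permute:
  assumes "p permutes I"
  shows "hom_poly I d P \<Longrightarrow> hom_poly I d (permute_vars p P)"
proof (induction rule: hom_poly.induct)
  case (var i d P)
  then have "p i \<in> I" using assms by (simp add: permutes_in_image)
  then show ?case using var by (simp add: permute_vars_ring hom_poly.var)
qed (simp_all add: permute_vars_ring hom_poly.intros)

lemma admissible_permute:
  assumes "p permutes I" "admissible I d P"
  shows "admissible I d (permute_vars p P)"
  unfolding admissible_def
proof (intro conjI allI impI)
  show "hom_poly I d (permute_vars p P)"
    by (rule hom_poly_permute[OF assms(1) admissible_hom_poly[OF assms(2)]])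
  fix a :: "nat \<Rightarrow> int"
  assume a: "\<forall>i\<in>I. a i \<le> 1" "int (card I) + 1 \<le> sum a I + int d"
  have "sum (\<lambda>i. a (p i)) I = sum a I"
    using sum.permute[OF assms(1), of a] by (simp add: comp_def)
  then have "P (\<lambda>i. of_int (a (p i))) = 0"
    using a assms by (intro admissible_eval[OF assms(2)]) (auto simp: permutes_in_image)
  then show "permute_vars p P (\<lambda>i. of_int (a i)) = 0"
    by (simp add: permute_vars_def comp_def)
qed

section \<open>Symmetric admissible polynomials vanish\<close>

definition symmetric_in :: "nat set \<Rightarrow> 'k::field_char_0 poly_fun \<Rightarrow> bool" where
  "symmetric_in I P \<longleftrightarrow> (\<forall>a\<in>I. \<forall>b\<in>I. permute_vars (transpose a b) P = P)"

lemma symmetric_in_eval: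
  "symmetric_in I P \<Longrightarrow> a \<in> I \<Longrightarrow> b \<in> I \<Longrightarrow> P (t \<circ> transpose a b) = P t"
  by (metis symmetric_in_def permute_vars_def)

text \<open>First-order Taylor expansion at (1, ..., 1). The gradient g is chosen before the
  direction h, so that coordinate directions and the diagonal can be compared; only the remainder
  depends on h.\<close>

lemma gradient_at_one:
  assumes "finite I"
  shows "hom_poly I d P \<Longrightarrow> \<exists>g. \<forall>h. \<exists>r. \<forall>e.
     P (\<lambda>i. 1 + e * h i) = P 1 + e * (\<Sum>i\<in>I. g i * h i) + e\<^sup>2 * poly r (e :: 'k::field_char_0)"
proof (induction rule: hom_poly.induct)
  case (zero d)
  show ?case by (rule exI[of _ "\<lambda>_. 0"], rule allI, rule exI[of _ 0]) (simp add: pointwise)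
next
  case (const c)
  show ?case by (rule exI[of _ "\<lambda>_. 0"], rule allI, rule exI[of _ 0]) (simp add: pointwise)
next
  case (var i d P)
  then obtain g where g: "\<And>h. \<exists>r. \<forall>e. P (\<lambda>i. 1 + e * h i) = P 1 + e * (\<Sum>i\<in>I. g i * h i) + e\<^sup>2 * poly r e"
    by blast
  show ?case
  proof (rule exI[of _ "\<lambda>l. g l + (if l = i then P 1 else 0)"], rule allI)
    fix h
    obtain r where r: "\<And>e. P (\<lambda>i. 1 + e * h i) = P 1 + e * (\<Sum>i\<in>I. g i * h i) + e\<^sup>2 * poly r e"
      using g by blast
    have "(\<Sum>l\<in>I. (g l + (if l = i then P 1 else 0)) * h l) = (\<Sum>i\<in>I. g i * h i) + P 1 * h i"
    proof -
      have "(\<Sum>l\<in>I. (g l + (if l = i then P 1 else 0)) * h l)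
          = (\<Sum>l\<in>I. g l * h l) + (\<Sum>l\<in>I. if l = i then P 1 * h i else 0)"
        unfolding sum.distrib[symmetric] by (rule sum.cong) (auto simp: distrib_right)
      then show ?thesis using var \<open>finite I\<close> by simp
    qed
    then have "\<forall>e. (coord i * P) (\<lambda>i. 1 + e * h i) = (coord i * P) 1
        + e * (\<Sum>l\<in>I. (g l + (if l = i then P 1 else 0)) * h l)
        + e\<^sup>2 * poly ([:h i * (\<Sum>i\<in>I. g i * h i):] + [:1, h i:] * r) e"
      by (simp add: pointwise r algebra_simps power2_eq_square)
    then show "\<exists>r. \<forall>e. (coord i * P) (\<lambda>i. 1 + e * h i) = (coord i * P) 1
        + e * (\<Sum>l\<in>I. (g l + (if l = i then P 1 else 0)) * h l) + e\<^sup>2 * poly r e" by blast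
  qed
next
  case (add d P Q)
  then obtain g g' where
    g: "\<And>h. \<exists>r. \<forall>e. P (\<lambda>i. 1 + e * h i) = P 1 + e * (\<Sum>i\<in>I. g i * h i) + e\<^sup>2 * poly r e" and
    g': "\<And>h. \<exists>r. \<forall>e. Q (\<lambda>i. 1 + e * h i) = Q 1 + e * (\<Sum>i\<in>I. g' i * h i) + e\<^sup>2 * poly r e"
    by blast
  show ?case
  proof (rule exI[of _ "\<lambda>l. g l + g' l"], rule allI)
    fix h
    obtain r r' where r: "\<And>e. P (\<lambda>i. 1 + e * h i) = P 1 + e * (\<Sum>i\<in>I. g i * h i) + e\<^sup>2 * poly r e"
      and r': "\<And>e. Q (\<lambda>i. 1 + e * h i) = Q 1 + e * (\<Sum>i\<in>I. g' i * h i) + e\<^sup>2 * poly r' e"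
      using g g' by blast
    show "\<exists>r. \<forall>e. (P + Q) (\<lambda>i. 1 + e * h i) = (P + Q) 1
        + e * (\<Sum>l\<in>I. (g l + g' l) * h l) + e\<^sup>2 * poly r e"
      by (rule exI[of _ "r + r'"]) (simp add: pointwise r r' algebra_simps sum.distrib)
  qed
qed

lemma linear_coeff_eqI:
  assumes "\<And>e. e * a + e\<^sup>2 * poly r e = poly f (e :: 'k::field_char_0)"
  shows "a = coeff f 1"
proof -
  have "poly (pCons 0 (pCons a r)) = poly f"
    using assms by (auto simp: fun_eq_iff power2_eq_square algebra_simps)
  then have "pCons 0 (pCons a r) = f" by (simp add: poly_eq_poly_eq_iff)
  then show ?thesis by auto
qed

lemma deg_below_restrict_poly:
  assumes "n \<notin> I"
  shows "deg_below {n} I d j Q \<Longrightarrow> \<exists>f. (\<forall>i\<ge>j. coeff f i = 0) \<and> (\<forall>x. Q (t(n := x)) = poly f x)"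
proof (induction rule: deg_below.induct)
  case (zero d j) show ?case by (rule exI[of _ 0]) (simp add: pointwise)
next
  case (base d P j)
  have "P (t(n := x)) = P t" for x
    by (rule hom_poly_cong[OF base(1)]) (use assms in auto)
  then show ?case by (intro exI[of _ "[:P t:]"]) (auto simp: coeff_pCons fun_upd_def split: nat.split)
next
  case (var x d j P)
  then obtain f where "\<And>i. i \<ge> j \<Longrightarrow> coeff f i = 0" "\<And>x. P (t(n := x)) = poly f x" by blast
  then show ?case using var
    by (intro exI[of _ "pCons 0 f"]) (auto simp: pointwise coeff_pCons fun_upd_def split: nat.split)
next
  case (add d j P Q)
  then obtain f g where "\<And>i. i \<ge> j \<Longrightarrow> coeff f i = 0" "\<And>x. P (t(n := x)) = poly f x"
    "\<And>i. i \<ge> j \<Longrightarrow> coeff g i = 0" "\<And>x. Q (t(n := x)) = poly g x" by blast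
  then show ?case by (intro exI[of _ "f + g"]) (auto simp: pointwise fun_upd_def)
qed

text \<open>The difference of the two sides has degree below d, but the d distinct roots 1, 0, ...,
  2 - d.\<close>

lemma poly_eq_shifted_factorial:
  fixes f :: "'k::field_char_0 poly"
  assumes "\<And>i. i > d \<Longrightarrow> coeff f i = 0" "coeff f d = c" "\<And>k. k < d \<Longrightarrow> poly f (1 - of_nat k) = 0"
  shows "f = smult c (\<Prod>k<d. [:of_nat k - 1, 1:])"
proof (rule ccontr)
  let ?g = "\<Prod>k<d. [:of_nat k - 1, 1 :: 'k:]"
  let ?p = "f - smult c ?g"
  assume "f \<noteq> smult c ?g"
  then have ne: "?p \<noteq> 0" by simp
  have deg: "degree ?g = d" and lc: "coeff ?g d = 1"
  proof -
    show "degree ?g = d" by (subst degree_prod_sum_eq) auto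
    then show "coeff ?g d = 1" using lead_coeff_prod[of "\<lambda>k. [:of_nat k - 1, 1 :: 'k:]" "{..<d}"] by simp
  qed
  have "coeff ?p i = 0" if "i \<ge> d" for i
    using that assms(1)[of i] assms(2) lc deg by (cases "i = d") (auto simp: coeff_eq_0)
  then have "degree ?p < d"
    using ne by (metis leading_coeff_0_iff not_less)
  moreover have "(\<lambda>k. 1 - of_nat k) ` {..<d} \<subseteq> {x. poly ?p x = 0}"
    using assms(3) by (auto simp: poly_prod)
  then have "d \<le> card {x. poly ?p x = 0}"
    using card_mono[OF poly_roots_finite[OF ne]] card_image[of "\<lambda>k. 1 - of_nat k :: 'k" "{..<d}"]
    unfolding inj_on_def by (metis card_lessThan diff_left_imp_eq of_nat_eq_iff diff_add_cancel add_left_cancel)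
  ultimately show False using card_poly_roots_bound[OF ne] by linarith
qed

text \<open>The derivative at 0 of e (e + 1) ... (e + d - 1). It is nonzero in characteristic 0, so
  a partial derivative at (1, ..., 1) detects the leading coefficient c.\<close>

lemma coeff_1_rising_factorial:
  assumes "d > 0"
  shows "coeff (\<Prod>k<d. [:of_nat k, 1 :: 'k::field_char_0:]) 1 = fact (d - 1)"
proof -
  obtain e where d: "d = Suc e" using assms by (cases d) auto
  have "(\<Prod>k<d. [:of_nat k, 1 :: 'k:]) = [:0, 1:] * (\<Prod>k<e. [:of_nat (Suc k), 1:])"
    unfolding d by (subst prod.lessThan_Suc_shift) simp
  then have "coeff (\<Prod>k<d. [:of_nat k, 1 :: 'k:]) 1 = poly (\<Prod>k<e. [:of_nat (Suc k), 1 :: 'k:]) 0"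
    by (simp add: coeff_pCons poly_0_coeff_0)
  also have "\<dots> = (\<Prod>k<e. of_nat (Suc k))" by (simp add: poly_prod)
  also have "\<dots> = fact e" by (induction e) (auto simp: algebra_simps)
  finally show ?thesis by (simp add: d)
qed

text \<open>The restriction \<open>P(1, \<dots>, 1, x) = c (x - 1) x (x + 1) \<cdots> (x + d - 2)\<close> is forced by its
  zeros, which gives the partial derivatives of \<open>P\<close> at \<open>(1, \<dots>, 1)\<close>; by Euler's identity they sum
  to \<open>d P(1, \<dots>, 1) = 0\<close>.\<close>

lemma symmetric_admissible_pure_power:
  fixes P :: "'k::field_char_0 poly_fun"
  assumes adm: "admissible I d P" and "finite I" and sym: "symmetric_in I P" and "n \<in> I" "d > 0"
    and low: "deg_below {n} (I - {n}) d d (P - coord n ^ d * cst c)"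
  shows "c = 0"
proof -
  have P1: "P 1 = 0"
    using admissible_eval[OF adm, of "\<lambda>_. 1"] \<open>d > 0\<close> by (simp add: one_fun_def)
  obtain f where f: "\<And>i. i \<ge> d \<Longrightarrow> coeff f i = 0"
    "\<And>x. (P - coord n ^ d * cst c) ((1 :: nat \<Rightarrow> 'k)(n := x)) = poly f x"
    using deg_below_restrict_poly[OF _ low, of 1] by auto
  let ?f = "f + monom c d"
  have Pf: "P ((1 :: nat \<Rightarrow> 'k)(n := x)) = poly ?f x" for x
    using f(2)[of x] by (simp add: pointwise poly_monom algebra_simps)
  have "?f = smult c (\<Prod>k<d. [:of_nat k - 1, 1:])"
  proof (rule poly_eq_shifted_factorial)
    fix k assume "k < d"
    \<comment> \<open>The coordinate sum of this point is card I - k, which meets the threshold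
      exactly when k < d; so there are d zeros.\<close>
    let ?a = "(\<lambda>_. 1 :: int)(n := 1 - int k)"
    have "sum ?a I = 1 - int k + int (card (I - {n}))"
      using assms by (subst sum.remove[of _ n]) auto
    moreover have "card I > 0" using assms by (auto simp: card_gt_0_iff)
    ultimately have "P (\<lambda>i. of_int (?a i)) = 0"
      using \<open>k < d\<close> assms by (intro admissible_eval[OF adm]) (auto simp: of_nat_diff)
    moreover have "(\<lambda>i. of_int (?a i)) = (1 :: nat \<Rightarrow> 'k)(n := 1 - of_nat k)"
      by (auto simp: fun_eq_iff one_fun_apply)
    ultimately show "poly ?f (1 - of_nat k) = 0" using Pf by (simp only:)
  qed (use f in auto)
  then have Pn: "P ((1 :: nat \<Rightarrow> 'k)(n := 1 + e)) = poly (smult c (\<Prod>k<d. [:of_nat k, 1:])) e" for e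
    by (simp add: Pf poly_prod algebra_simps)
  obtain g where g: "\<And>h. \<exists>r. \<forall>e. P (\<lambda>i. 1 + e * h i) = P 1 + e * (\<Sum>i\<in>I. g i * h i) + e\<^sup>2 * poly r e"
    using gradient_at_one[OF \<open>finite I\<close> admissible_hom_poly[OF adm]] by blast
  \<comment> \<open>The direction n is computed from the product formula; symmetry carries the
    result to every other direction.\<close>
  have gi: "g i = c * fact (d - 1)" if "i \<in> I" for i
  proof -
    obtain r where "\<And>e. P (\<lambda>l. 1 + e * of_bool (l = i)) = P 1 + e * (\<Sum>l\<in>I. g l * of_bool (l = i)) + e\<^sup>2 * poly r e"
      using g[of "\<lambda>l. of_bool (l = i)"] by blast
    moreover have "P (\<lambda>l. 1 + e * of_bool (l = i)) = P ((1 :: nat \<Rightarrow> 'k)(n := 1 + e))" for e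
    proof -
      have "(\<lambda>l. 1 + e * of_bool (l = i)) = (1 :: nat \<Rightarrow> 'k)(n := 1 + e) \<circ> transpose i n"
        by (auto simp: fun_eq_iff one_fun_apply transpose_def)
      then show ?thesis using symmetric_in_eval[OF sym that \<open>n \<in> I\<close>] by simp
    qed
    moreover have "(\<Sum>l\<in>I. g l * of_bool (l = i)) = g i"
      using that \<open>finite I\<close> by simp
    ultimately have "g i = coeff (smult c (\<Prod>k<d. [:of_nat k, 1:])) 1"
      by (intro linear_coeff_eqI[of _ r]) (simp add: Pn P1)
    then show ?thesis using coeff_1_rising_factorial[OF \<open>d > 0\<close>, where 'k='k] by simp
  qed
  obtain r where r: "\<And>e. P (\<lambda>i. 1 + e * 1) = P 1 + e * (\<Sum>i\<in>I. g i * 1) + e\<^sup>2 * poly r e"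
    using g[of "\<lambda>_. 1"] by blast
  have "P (\<lambda>i. 1 + e * 1) = 0" for e
    using hom_poly_scaling[OF admissible_hom_poly[OF adm], of "1 + e" 1] P1 by (simp add: one_fun_apply)
  then have "sum g I = coeff 0 1"
    using r P1 by (intro linear_coeff_eqI[of _ r]) simp
  then have "of_nat (card I) * (c * fact (d - 1)) = 0"
    by (simp add: gi)
  then show ?thesis using assms by auto
qed

text \<open>Descent on the degree k in t_n. The leading coefficient is symmetric and admissible in
  one variable less: for 0 < k < d it vanishes by induction, for k = d by
  \<open>symmetric_admissible_pure_power\<close>. For k = 0 the polynomial does not depend on t_n,
  hence by symmetry on no variable of I, and d > 0 forces it to be 0.\<close>

lemma symmetric_admissible_eq_0:
  fixes P :: "'k::field_char_0 poly_fun"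
  assumes "finite I" "admissible I d P" "symmetric_in I P" "0 < d" "d < card I"
  shows "P = 0"
  using assms
proof (induction "card I" arbitrary: I d P rule: less_induct)
  case less
  obtain n where n: "n \<in> I" using less.prems by (metis card.empty ex_in_conv not_less0)
  let ?I = "I - {n}"
  have I: "insert n ?I = I" "finite ?I" "n \<notin> ?I"
    using n less.prems(1) by auto
  have card: "card I = Suc (card ?I)"
    using n less.prems(1) by (rule card.remove[rotated])
  have "deg_below {n} ?I d j P \<Longrightarrow> P = 0" for j
  proof (induction j)
    case 0 then show ?case using deg_below_0 by blast
  next
    case (Suc k)
    obtain q where q: "hom_poly ?I (d - k) q" "d < k \<Longrightarrow> q = 0"
      and low: "deg_below {n} ?I d k (P - coord n ^ k * q)"
      using top_coeff_one[OF Suc.prems] by blast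
    have "q = 0 \<or> k = 0"
    proof (cases "k = 0 \<or> d < k")
      case False
      then have k: "0 < k" "k \<le> d" by auto
      have adm: "admissible ?I (d - k) q"
        by (rule admissible_top_one[OF _ I(2,3) q(1) k(2) low]) (use less.prems(2) I(1) in metis)
      obtain w :: "nat \<Rightarrow> 'k"
        where w: "\<And>i. i \<le> k \<Longrightarrow> (\<Sum>l\<le>k. w l * (1 - of_nat l) ^ i) = (if i = k then 1 else 0)"
        using difference_weights by blast
      note q_eq = top_coeff_eq_difference[OF w I(3) q(1) low]
      \<comment> \<open>q is a combination of values of P with t_n fixed at the nodes, and
        transpositions within I - {n} leave t_n alone.\<close>
      have sym: "symmetric_in ?I q"
        unfolding symmetric_in_def permute_vars_def
      proof (intro ballI ext)
        fix a b t assume ab: "a \<in> ?I" "b \<in> ?I"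
        have "(t \<circ> transpose a b)(n := x) = t(n := x) \<circ> transpose a b" for x :: 'k
          using ab by (auto simp: fun_eq_iff transpose_def)
        then have "P ((t \<circ> transpose a b)(n := x)) = P (t(n := x))" for x
          using symmetric_in_eval[OF less.prems(3), of a b] ab by simp
        then show "q (t \<circ> transpose a b) = q t" 
          using q_eq[of "t \<circ> transpose a b"] q_eq[of t] by (simp only:)
      qed
      show ?thesis
      proof (cases "k = d")
        case True
        then obtain c where c: "q = cst c" using hom_poly_0_const[OF q(1)] by auto
        have "c = 0"
          by (rule symmetric_admissible_pure_power[OF less.prems(2,1,3) n less.prems(4)])
            (use low True c in simp)
        then show ?thesis using c by (simp add: fun_eq_iff pointwise)
      next
        case False
        then have "q = 0" using less.hyps[OF _ I(2) adm sym] k less.prems card by auto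
        then show ?thesis by simp
      qed
    qed (use q in auto)
    then show ?case
    proof
      assume "q = 0" then show ?thesis using Suc.IH low by simp
    next
      assume "k = 0"
      then have "P = q" using low deg_below_0[OF low] by simp
      have upd: "P (t(i := x)) = P t" if "i \<in> I" for i x t
      proof -
        have "t(i := x) \<circ> transpose i n = (t \<circ> transpose i n)(n := x)"
          by (auto simp: fun_eq_iff transpose_def)
        then have "P (t(i := x)) = P ((t \<circ> transpose i n)(n := x))"
          using symmetric_in_eval[OF less.prems(3) that n, of "t(i := x)"] by simp
        also have "\<dots> = P (t \<circ> transpose i n)"
          unfolding \<open>P = q\<close> by (rule hom_poly_cong[OF q(1)]) auto
        finally show ?thesis using symmetric_in_eval[OF less.prems(3) that n] by simp
      qed
      have "P (\<lambda>i. if i \<in> J then 0 else t i) = P t" if "finite J" "J \<subseteq> I" for J t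
        using that
      proof (induction J rule: finite_induct)
        case (insert i J)
        have "(\<lambda>l. if l \<in> insert i J then 0 else t l) = (\<lambda>l. if l \<in> J then 0 else t l)(i := 0)"
          by (auto simp: fun_eq_iff)
        then show ?case using insert upd[of i] by simp
      qed simp
      moreover have "P (\<lambda>i. if i \<in> I then 0 else t i) = 0" for t
        using hom_poly_scaling[OF admissible_hom_poly[OF less.prems(2)], of 0 t] less.prems(4)
          hom_poly_cong[OF admissible_hom_poly[OF less.prems(2)], of "\<lambda>i. if i \<in> I then 0 else t i" "\<lambda>i. 0 * t i"]
        by simp
      ultimately show ?thesis using less.prems(1) by (auto simp: fun_eq_iff pointwise)
    qed
  qed
  moreover have "deg_below {n} ?I d (Suc d) P"
    using hom_poly_deg_below[of "{n}" ?I d P] admissible_hom_poly[OF less.prems(2)] I(1) by simp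
  ultimately show ?case by blast
qed

section \<open>Symbols of Lie elements\<close>

text \<open>The derivation multiplies the symbol of a multilinear element on \<open>I\<close> by \<open>coord_sum I\<close>, which gives
  the factor in the rule for \<open>[f, g] = f D(g) - g D(f)\<close>.\<close>

inductive lie_symbol :: "nat set \<Rightarrow> 'k::field_char_0 poly_fun \<Rightarrow> bool" where
  zero: "finite I \<Longrightarrow> I \<noteq> {} \<Longrightarrow> lie_symbol I 0"
| gen: "lie_symbol {i} 1"
| bracket: "lie_symbol I P \<Longrightarrow> lie_symbol J Q \<Longrightarrow> I \<inter> J = {}
    \<Longrightarrow> lie_symbol (I \<union> J) (P * Q * (coord_sum J - coord_sum I))"
| add: "lie_symbol I P \<Longrightarrow> lie_symbol I Q \<Longrightarrow> lie_symbol I (P + Q)"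
| scale: "lie_symbol I P \<Longrightarrow> lie_symbol I (cst c * P)"

lemma lie_symbol_finite: "lie_symbol I P \<Longrightarrow> finite I"
  by (induction rule: lie_symbol.induct) auto

lemma lie_symbol_nonempty: "lie_symbol I P \<Longrightarrow> I \<noteq> {}"
  by (induction rule: lie_symbol.induct) auto

lemma lie_symbol_card: "lie_symbol I P \<Longrightarrow> card I > 0"
  by (simp add: card_gt_0_iff lie_symbol_finite lie_symbol_nonempty)

lemma lie_symbol_diff: "lie_symbol I P \<Longrightarrow> lie_symbol I Q \<Longrightarrow> lie_symbol I (P - Q)"
  unfolding minus_eq_cst by (intro lie_symbol.add lie_symbol.scale)

lemma lie_symbol_sum:
  "finite I \<Longrightarrow> I \<noteq> {} \<Longrightarrow> (\<And>a. a \<in> A \<Longrightarrow> lie_symbol I (P a)) \<Longrightarrow> lie_symbol I (\<Sum>a\<in>A. P a)"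
  by (induction A rule: infinite_finite_induct) (auto intro: lie_symbol.zero lie_symbol.add)

text \<open>Guarantees that an admissible polynomial stays admissible when a Lie symbol is
  subtracted from it.\<close>

lemma lie_symbol_admissible: "lie_symbol I P \<Longrightarrow> admissible I (card I - 1) P"
proof (induction rule: lie_symbol.induct)
  case (gen i)
  show ?case by (auto simp: admissible_def hom_poly_one)
next
  case (bracket I P J Q)
  then show ?case by (intro admissible_bracket lie_symbol_finite lie_symbol_nonempty)
qed (auto intro: admissible_zero admissible_add admissible_cst)

lemma lie_symbol_hom_poly: "lie_symbol I P \<Longrightarrow> hom_poly I (card I - 1) P"
  by (intro admissible_hom_poly lie_symbol_admissible)

lemma permute_coord_sum: "inj p \<Longrightarrow> permute_vars p (coord_sum I) = coord_sum (p ` I)"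
  unfolding coord_sum_eq_sum permute_vars_ring
  by (subst sum.reindex) (auto simp: inj_on_def)

lemma lie_symbol_permute:
  assumes "inj p"
  shows "lie_symbol I P \<Longrightarrow> lie_symbol (p ` I) (permute_vars p P)"
proof (induction rule: lie_symbol.induct)
  case (gen i)
  have "permute_vars p 1 = (1 :: 'a poly_fun)" by (simp add: permute_vars_def fun_eq_iff pointwise)
  then show ?case by (simp add: lie_symbol.gen)
next
  case (bracket I P J Q)
  have "p ` I \<inter> p ` J = {}" using bracket assms by (auto simp: inj_def)
  then show ?case
    using lie_symbol.bracket[OF bracket.IH] assms by (simp add: permute_vars_ring permute_coord_sum image_Un)
qed (simp_all add: permute_vars_ring lie_symbol.intros)

text \<open>Substituting \<open>[x\<^sub>s, x\<^sub>u]\<close> for \<open>x\<^sub>s\<close> in a Lie element.\<close>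

definition merge_vars :: "nat \<Rightarrow> nat \<Rightarrow> 'k::field_char_0 poly_fun \<Rightarrow> 'k poly_fun" where
  "merge_vars s u P = (\<lambda>t. P (t(s := t s + t u)))"

text \<open>The bracket [x_s, x_u] has symbol t_u - t_s, and a derivation falling on it contributes
  t_s + t_u in place of t_s. In a bracket of two blocks only the block that contains s
  changes.\<close>

lemma lie_symbol_merge_vars:
  "lie_symbol I P \<Longrightarrow> u \<notin> I \<Longrightarrow> s \<in> I \<Longrightarrow>
    lie_symbol (insert u I) (merge_vars s u P * (coord u - coord s))"
proof (induction rule: lie_symbol.induct)
  case (zero I)
  have "merge_vars s u 0 * (coord u - coord s) = (0 :: 'a poly_fun)"
    by (simp add: merge_vars_def fun_eq_iff pointwise)
  then show ?case using zero by (simp add: lie_symbol.zero)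
next
  case (gen i)
  have eq: "1 * 1 * (coord_sum {u} - coord_sum {s}) = merge_vars s u 1 * (coord u - coord s :: 'a poly_fun)"
    by (simp add: merge_vars_def fun_eq_iff pointwise)
  have "lie_symbol ({s} \<union> {u}) (1 * 1 * (coord_sum {u} - coord_sum {s}) :: 'a poly_fun)"
    using gen by (intro lie_symbol.bracket lie_symbol.gen) auto
  moreover have "{s} \<union> {u} = insert u {i}" using gen by auto
  ultimately show ?case by (simp only: eq)
next
  case (bracket I P J Q)
  let ?\<sigma> = "\<lambda>t :: nat \<Rightarrow> 'a. t(s := t s + t u)"
  note fin = lie_symbol_finite[OF bracket.hyps(1)] lie_symbol_finite[OF bracket.hyps(2)]
  have csum: "coord_sum K (?\<sigma> t) = coord_sum (if s \<in> K then insert u K else K) t"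
    if "finite K" "u \<notin> K" for K t
  proof (cases "s \<in> K")
    case True
    then have "(\<Sum>i\<in>K. ?\<sigma> t i) = ?\<sigma> t s + (\<Sum>i\<in>K - {s}. ?\<sigma> t i)"
      using that by (simp add: sum.remove)
    also have "(\<Sum>i\<in>K - {s}. ?\<sigma> t i) = (\<Sum>i\<in>K - {s}. t i)" by (rule sum.cong) auto
    finally show ?thesis using True that by (simp add: coord_sum_apply sum.remove[of K s])
  next
    case False
    then have "(\<Sum>i\<in>K. ?\<sigma> t i) = (\<Sum>i\<in>K. t i)" by (intro sum.cong) auto
    then show ?thesis using False by (simp add: coord_sum_apply)
  qed
  have const: "R (?\<sigma> t) = R t" if "lie_symbol K R" "s \<notin> K" for K R t
    by (rule hom_poly_cong[OF lie_symbol_hom_poly[OF that(1)]]) (use that in auto)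
  consider "s \<in> I" "s \<notin> J" | "s \<in> J" "s \<notin> I" using bracket by auto
  then show ?case
  proof cases
    case 1
    have "lie_symbol (insert u I \<union> J) (merge_vars s u P * (coord u - coord s) * Q
        * (coord_sum J - coord_sum (insert u I)))"
      using 1 bracket by (intro lie_symbol.bracket) auto
    moreover have "merge_vars s u P * (coord u - coord s) * Q * (coord_sum J - coord_sum (insert u I))
      = merge_vars s u (P * Q * (coord_sum J - coord_sum I)) * (coord u - coord s)"
      using 1 bracket.prems csum[OF fin(1)] csum[OF fin(2)] const[OF bracket.hyps(2)]
      unfolding merge_vars_def fun_eq_iff pointwise(2,5) by simp
    ultimately show ?thesis by simp
  next
    case 2
    have "lie_symbol (I \<union> insert u J) (P * (merge_vars s u Q * (coord u - coord s))
        * (coord_sum (insert u J) - coord_sum I))"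
      using 2 bracket by (intro lie_symbol.bracket) auto
    moreover have "P * (merge_vars s u Q * (coord u - coord s)) * (coord_sum (insert u J) - coord_sum I)
      = merge_vars s u (P * Q * (coord_sum J - coord_sum I)) * (coord u - coord s)"
      using 2 bracket.prems csum[OF fin(1)] csum[OF fin(2)] const[OF bracket.hyps(1)]
      unfolding merge_vars_def fun_eq_iff pointwise(2,5) by simp
    ultimately show ?thesis by simp
  qed
next
  case (add I P Q)
  have "merge_vars s u (P + Q) * (coord u - coord s)
    = merge_vars s u P * (coord u - coord s) + merge_vars s u Q * (coord u - coord s)"
    by (simp add: merge_vars_def fun_eq_iff pointwise algebra_simps)
  then show ?case using lie_symbol.add[OF add.IH] add.prems by metis
next
  case (scale I P c)
  have "merge_vars s u (cst c * P) * (coord u - coord s)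
    = cst c * (merge_vars s u P * (coord u - coord s))"
    by (simp add: merge_vars_def fun_eq_iff pointwise)
  then show ?case using lie_symbol.scale[OF scale.IH, of c] scale.prems by metis
qed

text \<open>Modelled on the free Poisson algebra, spanned by commutative products of Lie elements; k
  counts the factors, whose variable sets partition I. The bound in \<open>zero\<close> keeps
  \<open>card I - k\<close> the true degree.\<close>

inductive poisson_symbol :: "nat set \<Rightarrow> nat \<Rightarrow> 'k::field_char_0 poly_fun \<Rightarrow> bool" where
  zero: "finite I \<Longrightarrow> k \<le> card I \<Longrightarrow> poisson_symbol I k 0"
| one: "poisson_symbol {} 0 1"
| mult: "lie_symbol I P \<Longrightarrow> poisson_symbol J k Q \<Longrightarrow> I \<inter> J = {} \<Longrightarrow> poisson_symbol (I \<union> J) (Suc k) (P * Q)"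
| add: "poisson_symbol I k P \<Longrightarrow> poisson_symbol I k Q \<Longrightarrow> poisson_symbol I k (P + Q)"
| scale: "poisson_symbol I k P \<Longrightarrow> poisson_symbol I k (cst c * P)"

lemma poisson_symbol_finite: "poisson_symbol I k P \<Longrightarrow> finite I"
  by (induction rule: poisson_symbol.induct) (auto simp: lie_symbol_finite)

lemma poisson_symbol_card: "poisson_symbol I k P \<Longrightarrow> k \<le> card I"
proof (induction rule: poisson_symbol.induct)
  case (mult I P J k Q)
  then have "card (I \<union> J) = card I + card J"
    by (simp add: card_Un_disjoint lie_symbol_finite poisson_symbol_finite)
  then show ?case using mult.IH lie_symbol_card[OF mult.hyps(1)] by simp
qed auto

text \<open>The easy half of the description of admissible polynomials. It also keeps remainders
  admissible during the descent.\<close>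

lemma poisson_symbol_admissible: "poisson_symbol I k P \<Longrightarrow> admissible I (card I - k) P"
proof (induction rule: poisson_symbol.induct)
  case one
  show ?case by (simp add: admissible_def hom_poly_one)
next
  case (mult I P J k Q)
  then have "card (I \<union> J) = card I + card J"
    by (simp add: card_Un_disjoint lie_symbol_finite poisson_symbol_finite)
  then have "card (I \<union> J) - Suc k = (card I - 1) + (card J - k)"
    using poisson_symbol_card[OF mult.hyps(2)] lie_symbol_card[OF mult.hyps(1)] by simp
  then show ?case
    using admissible_mult[OF lie_symbol_admissible[OF mult.hyps(1)] mult.IH] mult.hyps
    by (simp add: lie_symbol_finite poisson_symbol_finite)
qed (auto intro: admissible_zero admissible_add admissible_cst)

lemma lie_symbol_poisson: "lie_symbol I P \<Longrightarrow> poisson_symbol I 1 P"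
  using poisson_symbol.mult[OF _ poisson_symbol.one] by fastforce

text \<open>The empty product lives on the empty set; P = 0 is excluded because the rule
  \<open>zero\<close> admits k = 0 on every finite I.\<close>

lemma poisson_symbol_0: "poisson_symbol I k P \<Longrightarrow> k = 0 \<Longrightarrow> P \<noteq> 0 \<Longrightarrow> \<exists>c. P = cst c \<and> I = {}"
proof (induction rule: poisson_symbol.induct)
  case one
  show ?case by (rule exI[of _ 1]) (simp add: fun_eq_iff pointwise)
next
  case (add I k P Q)
  show ?case
  proof (cases "P = 0 \<or> Q = 0")
    case True then show ?thesis using add by auto
  next
    case False
    then obtain c c' where "P = cst c" "Q = cst c'" "I = {}" using add by blast
    then show ?thesis by (intro exI[of _ "c + c'"]) (simp add: fun_eq_iff pointwise)
  qed
next
  case (scale I k P c)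
  then have "P \<noteq> 0" by auto
  then obtain c' where "P = cst c'" "I = {}" using scale by blast
  then show ?case by (intro exI[of _ "c * c'"]) (simp add: fun_eq_iff pointwise)
qed auto

lemma poisson_symbol_1: "poisson_symbol I k P \<Longrightarrow> k = 1 \<Longrightarrow> lie_symbol I P"
proof (induction rule: poisson_symbol.induct)
  case (zero I k)
  then show ?case by (auto intro: lie_symbol.zero)
next
  case (mult I P J k Q)
  show ?case
  proof (cases "Q = 0")
    case True
    have "finite (I \<union> J)" "I \<union> J \<noteq> {}"
      using lie_symbol_finite[OF mult.hyps(1)] lie_symbol_nonempty[OF mult.hyps(1)]
        poisson_symbol_finite[OF mult.hyps(2)] by auto
    then show ?thesis by (simp add: True lie_symbol.zero)
  next
    case False
    then obtain c where "Q = cst c" "J = {}" using poisson_symbol_0[OF mult.hyps(2)] mult.prems by auto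
    then show ?thesis using lie_symbol.scale[OF mult.hyps(1), of c] by (simp add: mult.commute)
  qed
qed (auto intro: lie_symbol.intros)

section \<open>Lifting leading coefficients\<close>

lemma coord_sum_insert: "finite A \<Longrightarrow> s \<notin> A \<Longrightarrow> coord_sum (insert s A) = coord s + coord_sum A"
  by (simp add: fun_eq_iff pointwise)

text \<open>The bracket multiplies by t_s plus a linear form free of t_s. Hence the degree in t_s
  rises by one and the leading coefficient picks up the factor B, with sign +1 because B stands on
  the left.\<close>

lemma bracket_leading_term:
  assumes "s \<in> S" "s \<notin> A" "finite A" "hom_poly M d x"
    and low: "deg_below S M (d + i) i (F - coord s ^ i * x)"
    and B: "lie_symbol I B" and "A \<subseteq> M" "I \<subseteq> M"
  shows "deg_below S M (d + i + card I) (Suc i)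
    (B * F * (coord_sum (insert s A) - coord_sum I) - coord s ^ Suc i * (B * x))"
proof -
  note card = lie_symbol_card[OF B]
  have hB: "hom_poly M (card I - 1) B"
    using hom_poly_mono[OF lie_symbol_hom_poly[OF B]] assms by blast
  have "deg_below S M (d + i) (Suc i) (coord s ^ i * x)"
    using assms by (intro deg_below_monomial)
  then have "deg_below S M (d + i) (Suc i) ((F - coord s ^ i * x) + coord s ^ i * x)"
    using deg_below_mono[OF low, of "Suc i"] by (intro deg_below.add) auto
  then have F: "deg_below S M (d + i) (Suc i) F" by simp
  have "deg_below S M ((card I - 1 + Suc 0) + (d + i)) (Suc i) (B * (coord_sum A - coord_sum I) * F)"
    using assms by (intro deg_below_mult_hom F hom_poly_mult hB hom_poly_diff hom_poly_coord_sum)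
  moreover have "deg_below S M (Suc ((card I - 1) + (d + i))) (Suc i) (coord s * (B * (F - coord s ^ i * x)))"
    using assms by (intro deg_below.var deg_below_mult_hom low hB)
  ultimately have "deg_below S M (d + i + card I) (Suc i) (B * (coord_sum A - coord_sum I) * F
      + coord s * (B * (F - coord s ^ i * x)))"
    using card by (intro deg_below.add) (simp_all add: add_ac)
  then show ?thesis
    by (rule deg_below_eqI) (use assms in \<open>simp_all add: coord_sum_insert algebra_simps\<close>)
qed

text \<open>F is the block of x_n built so far, with leading term t_n^i x. Of the k factors of q, j
  are bracketed into this block and the others stay separate, so k - j + 1 factors result. The use
  is with F = x = 1 and i = 0; the general form carries the accumulated block through the
  induction.\<close>

lemma lift_leading_coeff:
  assumes "n \<notin> M" "finite M"
  shows "poisson_symbol I k q \<Longrightarrow> j \<le> k \<Longrightarrow> lie_symbol (insert n A) F \<Longrightarrow> A \<subseteq> M \<Longrightarrow> I \<subseteq> M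
    \<Longrightarrow> A \<inter> I = {} \<Longrightarrow> hom_poly M d x \<Longrightarrow> deg_below {n} M (d + i) i (F - coord n ^ i * x)
    \<Longrightarrow> \<exists>R. poisson_symbol (insert n (A \<union> I)) (Suc (k - j)) R \<and>
      deg_below {n} M (d + i + j + (card I - k)) (i + j) (R - coord n ^ (i + j) * (x * q))"
proof (induction arbitrary: A F x i j d rule: poisson_symbol.induct)
  case (zero I k)
  have fin: "finite A" using zero assms by (auto intro: finite_subset)
  have "n \<notin> A \<union> I" using zero assms by auto
  then have "card (insert n (A \<union> I)) = Suc (card A + card I)"
    using fin zero by (simp add: card_Un_disjoint)
  then have "poisson_symbol (insert n (A \<union> I)) (Suc (k - j)) 0"
    using fin zero by (intro poisson_symbol.zero) auto
  then show ?case by (intro exI[of _ 0]) (auto intro: deg_below.zero)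
next
  case one
  then show ?case by (intro exI[of _ F]) (auto intro: lie_symbol_poisson[simplified])
next
  case (mult I' B J k Q)
  show ?case
  proof (cases j)
    \<comment> \<open>Nothing is left to absorb: F joins the remaining product as one more
      factor.\<close>
    case 0
    have n: "insert n A \<inter> (I' \<union> J) = {}" using mult assms by auto
    have PQ: "poisson_symbol (I' \<union> J) (Suc k) (B * Q)"
      by (rule poisson_symbol.mult[OF mult.hyps])
    have "poisson_symbol (insert n A \<union> (I' \<union> J)) (Suc (Suc k)) (F * (B * Q))"
      by (rule poisson_symbol.mult[OF mult.prems(2) PQ n])
    moreover have "deg_below {n} M ((card (I' \<union> J) - Suc k) + (d + i)) i (B * Q * (F - coord n ^ i * x))"
      using hom_poly_mono[OF admissible_hom_poly[OF poisson_symbol_admissible[OF PQ]] mult.prems(4)]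
      by (intro deg_below_mult_hom mult.prems)
    then have "deg_below {n} M (d + i + j + (card (I' \<union> J) - Suc k)) (i + j)
        (F * (B * Q) - coord n ^ (i + j) * (x * (B * Q)))"
      by (rule deg_below_eqI) (simp_all add: 0 algebra_simps)
    ultimately show ?thesis using 0 by (intro exI[of _ "F * (B * Q)"]) simp
  next
    case (Suc j')
    have A: "n \<notin> A" "finite A" using mult assms by (auto intro: finite_subset)
    let ?F = "B * F * (coord_sum (insert n A) - coord_sum I')"
    have disj: "I' \<inter> insert n A = {}" using mult assms by auto
    have 1: "lie_symbol (I' \<union> insert n A) ?F"
      by (rule lie_symbol.bracket[OF mult.hyps(1) mult.prems(2) disj])
    have 2: "deg_below {n} M (d + i + card I') (Suc i) (?F - coord n ^ Suc i * (B * x))"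
      using mult A by (intro bracket_leading_term) auto
    have "hom_poly I' (card I' - 1) B" by (rule lie_symbol_hom_poly[OF mult.hyps(1)])
    then have 3: "hom_poly M (card I' - 1 + d) (B * x)"
      using mult by (intro hom_poly_mult) (auto intro: hom_poly_mono)
    have card: "card I' > 0" "card (I' \<union> J) = card I' + card J" "k \<le> card J"
      using mult.hyps lie_symbol_card poisson_symbol_card
      by (auto simp: card_Un_disjoint lie_symbol_finite poisson_symbol_finite)
    have "\<exists>R. poisson_symbol (insert n ((A \<union> I') \<union> J)) (Suc (k - j')) R \<and>
      deg_below {n} M ((card I' - 1 + d) + Suc i + j' + (card J - k)) (Suc i + j')
        (R - coord n ^ (Suc i + j') * ((B * x) * Q))"
    proof (rule mult.IH)
      show "lie_symbol (insert n (A \<union> I')) ?F" using 1 by (simp add: Un_commute)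
      show "deg_below {n} M (card I' - 1 + d + Suc i) (Suc i) (?F - coord n ^ Suc i * (B * x))"
        using 2 by (rule deg_below_eqI) (use card in auto)
    qed (use 3 mult Suc in auto)
    then obtain R where R: "poisson_symbol (insert n ((A \<union> I') \<union> J)) (Suc (k - j')) R"
      "deg_below {n} M ((card I' - 1 + d) + Suc i + j' + (card J - k)) (Suc i + j')
        (R - coord n ^ (Suc i + j') * ((B * x) * Q))" by blast
    have "deg_below {n} M (d + i + j + (card (I' \<union> J) - Suc k)) (i + j) (R - coord n ^ (i + j) * (x * (B * Q)))"
      using R(2) by (rule deg_below_eqI) (use Suc card in \<open>simp_all add: mult_ac\<close>)
    then show ?thesis using R(1) Suc by (intro exI[of _ R]) (simp add: Un_assoc)
  qed
next
  case (add I k P Q)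
  from add.IH(1)[OF add.prems] add.IH(2)[OF add.prems] obtain R R' where
    R: "poisson_symbol (insert n (A \<union> I)) (Suc (k - j)) R"
      "deg_below {n} M (d + i + j + (card I - k)) (i + j) (R - coord n ^ (i + j) * (x * P))" and
    R': "poisson_symbol (insert n (A \<union> I)) (Suc (k - j)) R'"
      "deg_below {n} M (d + i + j + (card I - k)) (i + j) (R' - coord n ^ (i + j) * (x * Q))" by blast
  have "deg_below {n} M (d + i + j + (card I - k)) (i + j) (R + R' - coord n ^ (i + j) * (x * (P + Q)))"
    by (rule deg_below_eqI[OF deg_below.add[OF R(2) R'(2)]]) (simp_all add: algebra_simps)
  then show ?case using poisson_symbol.add[OF R(1) R'(1)] by blast
next
  case (scale I k P c)
  from scale.IH[OF scale.prems] obtain R where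
    R: "poisson_symbol (insert n (A \<union> I)) (Suc (k - j)) R"
      "deg_below {n} M (d + i + j + (card I - k)) (i + j) (R - coord n ^ (i + j) * (x * P))" by blast
  have "deg_below {n} M (d + i + j + (card I - k)) (i + j) (cst c * R - coord n ^ (i + j) * (x * (cst c * P)))"
    by (rule deg_below_eqI[OF deg_below_cst[OF R(2), of c]]) (simp_all add: algebra_simps)
  then show ?case using poisson_symbol.scale[OF R(1)] by blast
qed

text \<open>Here all factors of q are absorbed, a of them into the block F of x_s and b into the
  block G of x_u. Bracketing the two finished blocks leaves a single Lie symbol and yields the
  factor t_u - t_s.\<close>

lemma lift_leading_coeff_pair:
  assumes "s \<notin> M" "u \<notin> M" "s \<noteq> u" "finite M"
  shows "poisson_symbol I k q \<Longrightarrow> k = a + b \<Longrightarrow> lie_symbol (insert s A) F \<Longrightarrow> lie_symbol (insert u C) G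
    \<Longrightarrow> A \<subseteq> M \<Longrightarrow> C \<subseteq> M \<Longrightarrow> I \<subseteq> M \<Longrightarrow> A \<inter> C = {} \<Longrightarrow> A \<inter> I = {} \<Longrightarrow> C \<inter> I = {}
    \<Longrightarrow> hom_poly M d x \<Longrightarrow> deg_below {s, u} M (d + i) i (F - coord s ^ i * x)
    \<Longrightarrow> hom_poly M e y \<Longrightarrow> deg_below {s, u} M (e + l) l (G - coord u ^ l * y)
    \<Longrightarrow> \<exists>R. lie_symbol (insert s (insert u (A \<union> C \<union> I))) R \<and>
      deg_below {s, u} M (d + i + e + l + Suc (card I)) (Suc (i + a + l + b))
        (R - (coord u - coord s) * coord s ^ (i + a) * coord u ^ (l + b) * (x * y * q))"
proof (induction arbitrary: a b A C F G x y i l d e rule: poisson_symbol.induct)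
  case (zero I k)
  have "finite (insert s (insert u (A \<union> C \<union> I)))"
    using zero assms by (auto intro: finite_subset)
  then show ?case by (intro exI[of _ 0]) (auto intro: deg_below.zero lie_symbol.zero)
next
  case one
  have fin: "finite A" "finite C" "s \<notin> A" "u \<notin> C"
    using one assms by (auto intro: finite_subset)
  let ?R = "F * G * (coord_sum (insert u C) - coord_sum (insert s A))"
  have disj: "insert s A \<inter> insert u C = {}" using one assms by auto
  have R: "lie_symbol (insert s A \<union> insert u C) ?R"
    by (rule lie_symbol.bracket[OF one.prems(2,3) disj])
  have mon: "deg_below {s, u} M (d + i) (Suc i) (coord s ^ i * x)"
    "deg_below {s, u} M (e + l) (Suc l) (coord u ^ l * y)"
    using one by (auto intro: deg_below_monomial)
  have F: "deg_below {s, u} M (d + i) (Suc i) F"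
    using deg_below.add[OF deg_below_mono[OF one.prems(11), of "Suc i"] mon(1)] by simp
  have G: "deg_below {s, u} M (e + l) (Suc l) G"
    using deg_below.add[OF deg_below_mono[OF one.prems(13), of "Suc l"] mon(2)] by simp
  have "deg_below {s, u} M ((d + i) + (e + l)) (i + l) ((F - coord s ^ i * x) * G)"
    by (rule deg_below_mult[OF one.prems(11) G])
  moreover have "deg_below {s, u} M ((e + l) + (d + i)) (l + i) ((G - coord u ^ l * y) * (coord s ^ i * x))"
    by (rule deg_below_mult[OF one.prems(13) mon(1)])
  \<comment> \<open>\<open>?L\<close> equals F G minus the product of the two leading terms.\<close>
  ultimately have low: "deg_below {s, u} M (d + i + e + l) (i + l)
      ((F - coord s ^ i * x) * G + (G - coord u ^ l * y) * (coord s ^ i * x))" (is "deg_below _ _ _ _ ?L")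
    by (intro deg_below.add) (simp_all add: add_ac)
  have "deg_below {s, u} M (Suc (d + i + e + l)) (Suc (i + l)) (coord u * ?L)"
    "deg_below {s, u} M (Suc (d + i + e + l)) (Suc (i + l)) (coord s * ?L)"
    by (intro deg_below.var low; simp)+
  moreover have "deg_below {s, u} M (Suc 0 + ((d + i) + (e + l))) (Suc i + l)
      ((coord_sum C - coord_sum A) * (F * G))"
    using one by (intro deg_below_mult_hom deg_below_mult[OF F G] hom_poly_diff hom_poly_coord_sum)
  then have "deg_below {s, u} M (Suc (d + i + e + l)) (Suc (i + l)) ((coord_sum C - coord_sum A) * (F * G))"
    by (rule deg_below_eqI) simp_all
  ultimately have "deg_below {s, u} M (Suc (d + i + e + l)) (Suc (i + l))
      (coord u * ?L - coord s * ?L + (coord_sum C - coord_sum A) * (F * G))"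
    by (intro deg_below.add deg_below_diff)
  then have "deg_below {s, u} M (d + i + e + l + Suc (card {})) (Suc (i + a + l + b))
      (?R - (coord u - coord s) * coord s ^ (i + a) * coord u ^ (l + b) * (x * y * 1))"
    by (rule deg_below_eqI) (use fin one in \<open>simp_all add: coord_sum_insert algebra_simps\<close>)
  moreover have "insert s A \<union> insert u C = insert s (insert u (A \<union> C \<union> {}))" by auto
  ultimately show ?case using R by metis
next
  case (mult I' B J k Q)
  have card: "card I' > 0" "card (I' \<union> J) = card I' + card J"
    using mult.hyps lie_symbol_card
    by (auto simp: card_Un_disjoint lie_symbol_finite poisson_symbol_finite)
  have fin: "finite A" "finite C" "s \<notin> A" "u \<notin> C"
    using mult assms by (auto intro: finite_subset)
  have hB: "hom_poly M (card I' - 1) B"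
    using hom_poly_mono[OF lie_symbol_hom_poly[OF mult.hyps(1)]] mult.prems by blast
  \<comment> \<open>The next factor may go into either block whose quota is not yet
    exhausted.\<close>
  from mult.prems(1) consider a' where "a = Suc a'" "k = a' + b" | b' where "b = Suc b'" "k = a + b'"
    by (cases a; cases b) auto
  then show ?case
  proof cases
    case 1
    let ?F = "B * F * (coord_sum (insert s A) - coord_sum I')"
    have disj: "I' \<inter> insert s A = {}" using mult assms by auto
    have F: "lie_symbol (I' \<union> insert s A) ?F"
      by (rule lie_symbol.bracket[OF mult.hyps(1) mult.prems(2) disj])
    have lead: "deg_below {s, u} M (d + i + card I') (Suc i) (?F - coord s ^ Suc i * (B * x))"
      using mult fin by (intro bracket_leading_term) auto
    have "\<exists>R. lie_symbol (insert s (insert u ((A \<union> I') \<union> C \<union> J))) R \<and>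
      deg_below {s, u} M ((card I' - 1 + d) + Suc i + e + l + Suc (card J)) (Suc (Suc i + a' + l + b))
        (R - (coord u - coord s) * coord s ^ (Suc i + a') * coord u ^ (l + b) * ((B * x) * y * Q))"
    proof (rule mult.IH)
      show "lie_symbol (insert s (A \<union> I')) ?F" using F by (simp add: Un_commute)
      show "deg_below {s, u} M (card I' - 1 + d + Suc i) (Suc i) (?F - coord s ^ Suc i * (B * x))"
        using lead by (rule deg_below_eqI) (use card in auto)
      show "hom_poly M (card I' - 1 + d) (B * x)"
        using hB mult.prems by (intro hom_poly_mult)
    qed (use mult 1 in auto)
    then obtain R where R: "lie_symbol (insert s (insert u ((A \<union> I') \<union> C \<union> J))) R"
      "deg_below {s, u} M ((card I' - 1 + d) + Suc i + e + l + Suc (card J)) (Suc (Suc i + a' + l + b))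
        (R - (coord u - coord s) * coord s ^ (Suc i + a') * coord u ^ (l + b) * ((B * x) * y * Q))" by blast
    have "deg_below {s, u} M (d + i + e + l + Suc (card (I' \<union> J))) (Suc (i + a + l + b))
        (R - (coord u - coord s) * coord s ^ (i + a) * coord u ^ (l + b) * (x * y * (B * Q)))"
      using R(2) by (rule deg_below_eqI) (use 1 card in \<open>simp_all add: mult_ac\<close>)
    moreover have "(A \<union> I') \<union> C \<union> J = A \<union> C \<union> (I' \<union> J)" by auto
    ultimately show ?thesis using R(1) by metis
  next
    case 2
    let ?G = "B * G * (coord_sum (insert u C) - coord_sum I')"
    have disj: "I' \<inter> insert u C = {}" using mult assms by auto
    have G: "lie_symbol (I' \<union> insert u C) ?G"
      by (rule lie_symbol.bracket[OF mult.hyps(1) mult.prems(3) disj])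
    have lead: "deg_below {s, u} M (e + l + card I') (Suc l) (?G - coord u ^ Suc l * (B * y))"
      using mult fin by (intro bracket_leading_term) auto
    have "\<exists>R. lie_symbol (insert s (insert u (A \<union> (C \<union> I') \<union> J))) R \<and>
      deg_below {s, u} M (d + i + (card I' - 1 + e) + Suc l + Suc (card J)) (Suc (i + a + Suc l + b'))
        (R - (coord u - coord s) * coord s ^ (i + a) * coord u ^ (Suc l + b') * (x * (B * y) * Q))"
    proof (rule mult.IH)
      show "lie_symbol (insert u (C \<union> I')) ?G" using G by (simp add: Un_commute)
      show "deg_below {s, u} M (card I' - 1 + e + Suc l) (Suc l) (?G - coord u ^ Suc l * (B * y))"
        using lead by (rule deg_below_eqI) (use card in auto)
      show "hom_poly M (card I' - 1 + e) (B * y)"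
        using hB mult.prems by (intro hom_poly_mult)
    qed (use mult 2 in auto)
    then obtain R where R: "lie_symbol (insert s (insert u (A \<union> (C \<union> I') \<union> J))) R"
      "deg_below {s, u} M (d + i + (card I' - 1 + e) + Suc l + Suc (card J)) (Suc (i + a + Suc l + b'))
        (R - (coord u - coord s) * coord s ^ (i + a) * coord u ^ (Suc l + b') * (x * (B * y) * Q))" by blast
    have "deg_below {s, u} M (d + i + e + l + Suc (card (I' \<union> J))) (Suc (i + a + l + b))
        (R - (coord u - coord s) * coord s ^ (i + a) * coord u ^ (l + b) * (x * y * (B * Q)))"
      using R(2) by (rule deg_below_eqI) (use 2 card in \<open>simp_all add: mult_ac\<close>)
    moreover have "A \<union> (C \<union> I') \<union> J = A \<union> C \<union> (I' \<union> J)" by auto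
    ultimately show ?thesis using R(1) by metis
  qed
next
  case (add I k P Q)
  let ?m = "(coord u - coord s) * coord s ^ (i + a) * coord u ^ (l + b)"
  from add.IH(1)[OF add.prems] add.IH(2)[OF add.prems] obtain R R' where
    R: "lie_symbol (insert s (insert u (A \<union> C \<union> I))) R"
      "deg_below {s, u} M (d + i + e + l + Suc (card I)) (Suc (i + a + l + b)) (R - ?m * (x * y * P))" and
    R': "lie_symbol (insert s (insert u (A \<union> C \<union> I))) R'"
      "deg_below {s, u} M (d + i + e + l + Suc (card I)) (Suc (i + a + l + b)) (R' - ?m * (x * y * Q))" by blast
  have "deg_below {s, u} M (d + i + e + l + Suc (card I)) (Suc (i + a + l + b)) (R + R' - ?m * (x * y * (P + Q)))"
    by (rule deg_below_eqI[OF deg_below.add[OF R(2) R'(2)]]) (simp_all add: algebra_simps)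
  then show ?case using lie_symbol.add[OF R(1) R'(1)] by blast
next
  case (scale I k P c)
  let ?m = "(coord u - coord s) * coord s ^ (i + a) * coord u ^ (l + b)"
  from scale.IH[OF scale.prems] obtain R where
    R: "lie_symbol (insert s (insert u (A \<union> C \<union> I))) R"
      "deg_below {s, u} M (d + i + e + l + Suc (card I)) (Suc (i + a + l + b)) (R - ?m * (x * y * P))" by blast
  have "deg_below {s, u} M (d + i + e + l + Suc (card I)) (Suc (i + a + l + b)) (cst c * R - ?m * (x * y * (cst c * P)))"
    by (rule deg_below_eqI[OF deg_below_cst[OF R(2), of c]]) (simp_all add: algebra_simps)
  then show ?case using lie_symbol.scale[OF R(1)] by blast
qed

section \<open>Invariance under transpositions modulo Lie symbols, in degree one less than the
  number of variables\<close>

lemma deg_below_transpose: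
  assumes "s \<notin> I" "u \<notin> I"
  shows "deg_below {s, u} I d j P \<Longrightarrow> deg_below {s, u} I d j (permute_vars (transpose s u) P)"
proof (induction rule: deg_below.induct)
  case (base d P j)
  have "permute_vars (transpose s u) P = P"
    unfolding permute_vars_def
    by (intro ext hom_poly_cong[OF base]) (use assms in \<open>auto simp: transpose_def\<close>)
  then show ?case using base by (simp add: deg_below.base)
next
  case (var x d j P)
  then show ?case by (auto simp: permute_vars_ring intro!: deg_below.var)
qed (simp_all add: permute_vars_ring deg_below.zero deg_below.add)

text \<open>\<open>IH\<close> is the hypothesis of the main induction for all sets smaller than
  \<open>insert s (insert u I)\<close>, which has card I + 2 elements and on which degree card I + 1
  is considered.\<close>

context
  fixes I :: "nat set" and s u :: nat
  assumes su: "s \<notin> I" "u \<notin> I" "s \<noteq> u" and fin: "finite I"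
    and IH: "\<And>J e Q :: 'k::field_char_0 poly_fun. finite J \<Longrightarrow> card J < card I + 2 \<Longrightarrow> admissible J e Q
      \<Longrightarrow> e < card J \<Longrightarrow> poisson_symbol J (card J - e) Q"
begin

text \<open>q has degree card I + 1 - k in card I variables, so by \<open>IH\<close> it is a sum of
  products of k - 1 = a + b Lie symbols, provided k is at least 2. For k = 1 its degree equals the
  number of variables and \<open>IH\<close> does not apply directly.\<close>

lemma lift_antisymmetric_step:
  fixes q :: "'k poly_fun"
  assumes q: "admissible I (Suc (card I) - k) q" and k: "0 < k" "k \<le> Suc (card I)" and ab: "Suc (a + b) = k"
  shows "\<exists>R. lie_symbol (insert s (insert u I)) R \<and> deg_below {s, u} I (Suc (card I)) k
    (R - (coord u - coord s) * coord s ^ a * coord u ^ b * q)"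
proof (cases "k = 1")
  case True
  \<comment> \<open>With s adjoined as a dummy variable, \<open>IH\<close> makes q a Lie symbol. As
    q does not depend on t_s, replacing x_s by [x_s, x_u] only multiplies it by t_u - t_s.\<close>
  have "admissible (insert s I) (card I) q"
    unfolding admissible_def
  proof (intro conjI allI impI)
    show "hom_poly (insert s I) (card I) q"
      using hom_poly_mono[OF admissible_hom_poly[OF q], of "insert s I"] True by auto
    fix z :: "nat \<Rightarrow> int"
    assume "\<forall>i\<in>insert s I. z i \<le> 1" "int (card (insert s I)) + 1 \<le> sum z (insert s I) + int (card I)"
    then show "q (\<lambda>i. of_int (z i)) = 0"
      using su fin True by (intro admissible_eval[OF q]) auto
  qed
  then have "poisson_symbol (insert s I) 1 q"
    using IH[of "insert s I" "card I" q] su fin by simp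
  then have "lie_symbol (insert s I) q" by (simp add: poisson_symbol_1)
  then have "lie_symbol (insert u (insert s I)) (merge_vars s u q * (coord u - coord s))"
    using su by (intro lie_symbol_merge_vars) auto
  moreover have "merge_vars s u q = q"
    unfolding merge_vars_def by (intro ext hom_poly_cong[OF admissible_hom_poly[OF q]]) (use su in auto)
  ultimately have "lie_symbol (insert s (insert u I)) (q * (coord u - coord s))"
    by (simp add: insert_commute)
  moreover have "q * (coord u - coord s) - (coord u - coord s) * coord s ^ a * coord u ^ b * q = 0"
    using True ab by simp
  ultimately show ?thesis by (metis deg_below.zero)
next
  case False
  then have k2: "2 \<le> k" using k by auto
  have "poisson_symbol I (card I - (Suc (card I) - k)) q"
    by (rule IH[OF fin _ q]) (use k k2 in linarith)+
  moreover have "card I - (Suc (card I) - k) = a + b" using k k2 ab by linarith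
  ultimately have ps: "poisson_symbol I (a + b) q" by (simp only:)
  have gens: "lie_symbol (insert s {}) 1" "lie_symbol (insert u {}) 1"
    by (auto intro: lie_symbol.gen)
  have "\<exists>R. lie_symbol (insert s (insert u ({} \<union> {} \<union> I))) R \<and>
      deg_below {s, u} I (0 + 0 + 0 + 0 + Suc (card I)) (Suc (0 + a + 0 + b))
        (R - (coord u - coord s) * coord s ^ (0 + a) * coord u ^ (0 + b) * (1 * 1 * q))"
    by (rule lift_leading_coeff_pair[OF su fin ps refl gens]) (simp_all add: hom_poly_one deg_below.zero)
  then show ?thesis using ab by simp
qed

text \<open>Telescoping: passing from t_s^a t_u^(k-a) to t_s^(a+1) t_u^(k-a-1) subtracts (t_u - t_s)
  t_s^a t_u^(k-a-1). Comparing every monomial with t_u^k covers all differences of two monomials of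
  degree k.\<close>

lemma lift_antisymmetric:
  fixes q :: "'k poly_fun"
  assumes q: "admissible I (Suc (card I) - k) q" and k: "0 < k" "k \<le> Suc (card I)" and "a \<le> k"
  shows "\<exists>R. lie_symbol (insert s (insert u I)) R \<and> deg_below {s, u} I (Suc (card I)) k
    (R - (coord s ^ a * coord u ^ (k - a) - coord u ^ k) * q)"
  using \<open>a \<le> k\<close>
proof (induction a)
  case 0
  then show ?case using fin by (intro exI[of _ 0]) (simp add: deg_below.zero lie_symbol.zero)
next
  case (Suc a)
  then obtain R where R: "lie_symbol (insert s (insert u I)) R"
    "deg_below {s, u} I (Suc (card I)) k (R - (coord s ^ a * coord u ^ (k - a) - coord u ^ k) * q)" by auto
  obtain R' where R': "lie_symbol (insert s (insert u I)) R'" "deg_below {s, u} I (Suc (card I)) k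
    (R' - (coord u - coord s) * coord s ^ a * coord u ^ (k - Suc a) * q)"
    using lift_antisymmetric_step[OF q k, of a "k - Suc a"] Suc.prems by auto
  have "k - a = Suc (k - Suc a)" using Suc.prems by simp
  then have "deg_below {s, u} I (Suc (card I)) k
      ((R - R') - (coord s ^ Suc a * coord u ^ (k - Suc a) - coord u ^ k) * q)"
    by (intro deg_below_eqI[OF deg_below_diff[OF R(2) R'(2)]]) (simp_all add: algebra_simps)
  then show ?case using lie_symbol_diff[OF R(1) R'(1)] by blast
qed

text \<open>Descent on the degree in t_s and t_u. The leading part of P minus its transpose is
  antisymmetric, hence the leading part of a Lie symbol \<open>?R\<close>; the difference
  \<open>?Q\<close> that remains is admissible of lower degree.\<close>

lemma admissible_minus_transpose:
  fixes P :: "'k poly_fun"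
  shows "admissible (insert s (insert u I)) (Suc (card I)) P \<Longrightarrow> deg_below {s, u} I (Suc (card I)) j P
    \<Longrightarrow> lie_symbol (insert s (insert u I)) (P - permute_vars (transpose s u) P)"
proof (induction j arbitrary: P)
  case 0
  then have "P = 0" using deg_below_0 by blast
  then show ?case using fin by (simp add: permute_vars_ring lie_symbol.zero)
next
  case (Suc k)
  let ?K = "insert s (insert u I)" and ?d = "Suc (card I)" and ?\<tau> = "permute_vars (transpose s u)"
  have fix_I: "?\<tau> q = q" if "hom_poly I e q" for e and q :: "'k poly_fun"
    unfolding permute_vars_def
    by (intro ext hom_poly_cong[OF that]) (use su in \<open>auto simp: transpose_def\<close>)
  have perm: "transpose s u permutes ?K" by (rule permutes_swap_id) auto
  have finK: "finite ?K" "?K \<noteq> {}" using fin by auto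
  obtain q where q: "\<And>a. hom_poly I (?d - k) (q a)" "\<And>a. ?d < k \<Longrightarrow> q a = 0"
    and low: "deg_below {s, u} I ?d k (P - (\<Sum>a\<le>k. coord s ^ a * coord u ^ (k - a) * q a))" (is "deg_below _ _ _ _ (P - ?S)")
    using top_coeff_two[OF Suc.prems(2)] by blast
  consider "k = 0" | "?d < k" | "0 < k" "k \<le> ?d" by linarith
  then show ?case
  proof cases
    case 1
    then have "P = q 0" using deg_below_0[OF low] by simp
    then have "P - ?\<tau> P = 0" using fix_I[OF q(1)] by simp
    then show ?thesis using lie_symbol.zero[OF finK] by metis
  next
    case 2
    then have "deg_below {s, u} I ?d k P" using low q by simp
    then show ?thesis using Suc.IH Suc.prems by blast
  next
    case 3
    have adm: "admissible I (?d - k) (q a)" if "a \<le> k" for a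
      by (rule admissible_top_two[OF Suc.prems(1) fin su q(1) 3(2) low that])
    \<comment> \<open>The contribution of \<open>q a\<close> to the leading part of P minus its
      transpose. It is the difference of two instances of \<open>lift_antisymmetric\<close>, for the
      exponents a and k - a.\<close>
    let ?A = "\<lambda>a. coord s ^ a * coord u ^ (k - a) * q a - coord u ^ a * coord s ^ (k - a) * q a"
    have "\<exists>R. lie_symbol ?K R \<and> deg_below {s, u} I ?d k (R - ?A a)" if a: "a \<le> k" for a
    proof -
      obtain R where R: "lie_symbol ?K R" "deg_below {s, u} I ?d k
          (R - (coord s ^ a * coord u ^ (k - a) - coord u ^ k) * q a)"
        using lift_antisymmetric[OF adm[OF a] 3 a] by blast
      obtain R' where R': "lie_symbol ?K R'" "deg_below {s, u} I ?d k
          (R' - (coord s ^ (k - a) * coord u ^ (k - (k - a)) - coord u ^ k) * q a)"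
        using lift_antisymmetric[OF adm[OF a] 3, of "k - a"] by auto
      have "deg_below {s, u} I ?d k ((R - R') - ?A a)"
        by (rule deg_below_eqI[OF deg_below_diff[OF R(2) R'(2)]]) (use a in \<open>simp_all add: algebra_simps\<close>)
      then show ?thesis using lie_symbol_diff[OF R(1) R'(1)] by blast
    qed
    then obtain r where r: "\<And>a. a \<le> k \<Longrightarrow> lie_symbol ?K (r a)"
      "\<And>a. a \<le> k \<Longrightarrow> deg_below {s, u} I ?d k (r a - ?A a)" by metis
    let ?R = "\<Sum>a\<le>k. r a"
    have R: "lie_symbol ?K ?R" using r finK by (intro lie_symbol_sum) auto
    let ?Q = "P - ?\<tau> P - ?R"
    have "?\<tau> ?S = (\<Sum>a\<le>k. coord u ^ a * coord s ^ (k - a) * q a)"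
      using fix_I[OF q(1)] by (simp add: permute_vars_ring)
    then have "?Q = (P - ?S) - ?\<tau> (P - ?S) - (\<Sum>a\<le>k. r a - ?A a)"
      by (simp add: permute_vars_ring sum_subtractf sum.distrib algebra_simps)
    moreover have "deg_below {s, u} I ?d k (\<Sum>a\<le>k. r a - ?A a)"
      using r(2) by (intro deg_below_sum) auto
    ultimately have lowQ: "deg_below {s, u} I ?d k ?Q"
      using low deg_below_transpose[OF su(1,2) low] by (simp only: deg_below_diff)
    have "card ?K - 1 = ?d" using su fin by simp
    then have "admissible ?K ?d ?Q"
      using lie_symbol_admissible[OF R] Suc.prems admissible_permute[OF perm Suc.prems(1)]
      by (intro admissible_diff) auto
    then have Q: "lie_symbol ?K (?Q - ?\<tau> ?Q)" using Suc.IH lowQ by blast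
    have "lie_symbol (transpose s u ` ?K) (?\<tau> ?R)"
      by (rule lie_symbol_permute[OF _ R]) simp
    then have "lie_symbol ?K (?\<tau> ?R)" using permutes_image[OF perm] by (simp only:)
    \<comment> \<open>The induction yields \<open>?Q\<close> minus its transpose, not
      \<open>?Q\<close> itself. Since \<open>?Q + ?R\<close> is antisymmetric, subtracting its
      transpose doubles it, which accounts for 1/2.\<close>
    then have "lie_symbol ?K (cst (1/2) * ((?Q - ?\<tau> ?Q) + (?R - ?\<tau> ?R)))"
      by (rule lie_symbol.scale[OF lie_symbol.add[OF Q lie_symbol_diff[OF R]]])
    moreover have "?\<tau> (?\<tau> P) = P" by (simp add: permute_vars_comp permute_vars_id)
    then have "cst (1/2) * ((?Q - ?\<tau> ?Q) + (?R - ?\<tau> ?R)) = P - ?\<tau> P"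
      unfolding permute_vars_ring by (simp add: fun_eq_iff pointwise field_simps)
    ultimately show ?thesis by simp
  qed
qed

end

text \<open>The coefficient of t_n^k has degree d - k in card I - 1 variables. For d + 1 < card I
  this is within the induction hypothesis for every k, including k = 0; for d + 1 = card I the
  coefficient of t_n^0 is not, hence the separate argument by symmetrisation.\<close>

theorem admissible_imp_poisson_symbol:
  fixes P :: "'k::field_char_0 poly_fun"
  assumes "finite I" "admissible I d P" "d < card I"
  shows "poisson_symbol I (card I - d) P"
  using assms
proof (induction "card I" arbitrary: I d P rule: less_induct)
  case less
  obtain n where n: "n \<in> I" using less.prems by (metis card.empty ex_in_conv not_less0)
  let ?I = "I - {n}"
  have I: "insert n ?I = I" "finite ?I" "n \<notin> ?I"
    using n less.prems(1) by auto
  have card: "card I = Suc (card ?I)"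
    using n less.prems(1) by (rule card.remove[rotated])
  show ?case
  proof (cases "Suc d < card I")
    case True
    have "admissible I d P \<Longrightarrow> deg_below {n} ?I d j P \<Longrightarrow> poisson_symbol I (card I - d) P"
      for j and P :: "'k poly_fun"
    proof (induction j arbitrary: P)
      case 0
      then have "P = 0" using deg_below_0 by blast
      then show ?case using less.prems by (simp add: poisson_symbol.zero)
    next
      case (Suc k)
      obtain q where q: "hom_poly ?I (d - k) q" "d < k \<Longrightarrow> q = 0"
        and low: "deg_below {n} ?I d k (P - coord n ^ k * q)"
        using top_coeff_one[OF Suc.prems(2)] by blast
      show ?case
      proof (cases "k \<le> d")
        case False
        then show ?thesis using q low Suc by simp
      next
        case k: True
        have adm: "admissible ?I (d - k) q"
          by (rule admissible_top_one[OF _ I(2,3) q(1) k low]) (use Suc.prems(1) I(1) in metis)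
        have ps: "poisson_symbol ?I (card ?I - (d - k)) q"
          by (rule less.hyps[OF _ I(2) adm]) (use card True in linarith)+
        \<comment> \<open>Of the card I - 1 - d + k factors of q, k are bracketed into x_n; with the
          block of x_n this leaves card I - d factors.\<close>
        have "\<exists>R. poisson_symbol (insert n ({} \<union> ?I)) (Suc (card ?I - (d - k) - k)) R \<and>
          deg_below {n} ?I (0 + 0 + k + (card ?I - (card ?I - (d - k)))) (0 + k) (R - coord n ^ (0 + k) * (1 * q))"
          by (rule lift_leading_coeff[OF I(3,2) ps, of k "{}" 1])
            (use card True k in linarith, simp_all add: hom_poly_one deg_below.zero lie_symbol.gen)
        moreover have "Suc (card ?I - (d - k) - k) = card I - d" using card k True by linarith
        moreover have "0 + 0 + k + (card ?I - (card ?I - (d - k))) = d" using card k True by linarith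
        moreover have "insert n ({} \<union> ?I) = I" using I by simp
        ultimately obtain R where R: "poisson_symbol I (card I - d) R"
          "deg_below {n} ?I d k (R - coord n ^ k * q)" by (metis add_0 mult_1)
        have "admissible I d R"
          using poisson_symbol_admissible[OF R(1)] less.prems by simp
        moreover have "deg_below {n} ?I d k (P - R)"
          by (rule deg_below_eqI[OF deg_below_diff[OF low R(2)]]) simp_all
        ultimately have "poisson_symbol I (card I - d) (P - R)"
          using Suc by (intro Suc.IH admissible_diff)
        then have "poisson_symbol I (card I - d) (P - R + R)" using R by (intro poisson_symbol.add)
        then show ?thesis by simp
      qed
    qed
    moreover have "deg_below {n} ?I d (Suc d) P"
      using hom_poly_deg_below[of "{n}" ?I d P] admissible_hom_poly[OF less.prems(2)] I(1) by simp
    ultimately show ?thesis using less.prems by blast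
  next
    case False
    then have d: "card I = Suc d" using less.prems by simp
    have "lie_symbol I P"
    proof (cases "d = 0")
      case True
      \<comment> \<open>For d = 0 a symmetric admissible polynomial may be a nonzero constant; here
        I is a singleton and P a multiple of the symbol of its generator.\<close>
      then obtain c where c: "P = cst c" using hom_poly_0_const admissible_hom_poly[OF less.prems(2)] by blast
      obtain i where "I = {i}" using d True by (metis One_nat_def card_1_singletonE)
      then show ?thesis using lie_symbol.scale[OF lie_symbol.gen, of i c] c by simp
    next
      case dpos: False
      have minus_transpose: "lie_symbol I (Q - permute_vars (transpose s u) Q)"
        if "admissible I d Q" "s \<in> I" "u \<in> I" "s \<noteq> u" for Q :: "'k poly_fun" and s u
      proof -
        let ?J = "I - {s} - {u}"
        have J: "I = insert s (insert u ?J)" "s \<notin> ?J" "u \<notin> ?J" "finite ?J" using that less.prems by auto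
        have "card I = Suc (Suc (card ?J))"
          by (subst card.remove[of I s], use that less.prems(1) in simp, use that in simp,
            subst card.remove[of "I - {s}" u]) (use that less.prems(1) in simp_all)
        then have cJ: "d = Suc (card ?J)" "card I = card ?J + 2" using d by auto
        have adm: "admissible (insert s (insert u ?J)) (Suc (card ?J)) Q"
          using that(1) by (simp only: J(1)[symmetric] cJ(1)[symmetric])
        have "hom_poly ({s, u} \<union> ?J) d Q"
          using admissible_hom_poly[OF that(1)] J(1) by (simp only: Un_insert_left Un_empty_left)
        then have low: "deg_below {s, u} ?J (Suc (card ?J)) (Suc d) Q"
          using hom_poly_deg_below[of "{s, u}" ?J d Q] by (simp only: cJ(1)[symmetric])
        have "poisson_symbol K (card K - e) R"
          if "finite K" "card K < card ?J + 2" "admissible K e R" "e < card K" for K e and R :: "'k poly_fun"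
          by (rule less.hyps[OF _ that(1,3,4)]) (use that(2) cJ(2) in linarith)
        then have "lie_symbol (insert s (insert u ?J)) (Q - permute_vars (transpose s u) Q)"
          by (rule admissible_minus_transpose[OF J(2,3) that(4) J(4) _ adm low])
        then show ?thesis by (simp only: J(1)[symmetric])
      qed
      have nonempty: "I \<noteq> {}" using n by auto
      have perm: "lie_symbol I (P - permute_vars p P)" if "p permutes I" for p
        using that less.prems(1)
      proof (induction p rule: permutes_induct)
        case id
        show ?case
          unfolding permute_vars_id using lie_symbol.zero[OF less.prems(1) nonempty] by simp
      next
        case (swap a b p)
        let ?P = "permute_vars p P"
        \<comment> \<open>The transposition is compared on the permuted polynomial, which is again
          admissible; the differences telescope along a product of transpositions.\<close>
        have "lie_symbol I ((P - ?P) + (?P - permute_vars (transpose a b) ?P))"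
          by (intro lie_symbol.add minus_transpose admissible_permute less.prems(2) swap)
        moreover have "(P - ?P) + (?P - permute_vars (transpose a b) ?P)
            = P - permute_vars (transpose a b \<circ> p) P"
          unfolding permute_vars_comp by simp
        ultimately show ?case by (simp only:)
      qed
      let ?G = "{p. p permutes I}"
      let ?S = "\<Sum>p\<in>?G. permute_vars p P"
      have "admissible I d (\<Sum>p\<in>A. permute_vars p P)" if "A \<subseteq> ?G" for A
        using that by (induction A rule: infinite_finite_induct)
          (auto intro: admissible_zero admissible_add admissible_permute less.prems)
      then have "admissible I d ?S" by blast
      moreover have "symmetric_in I ?S"
        unfolding symmetric_in_def
      proof (intro ballI)
        fix a b assume "a \<in> I" "b \<in> I"
        then have "transpose a b permutes I" by (rule permutes_swap_id)
        then show "permute_vars (transpose a b) ?S = ?S"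
          unfolding permute_vars_ring permute_vars_comp
          by (rule setum_permutations_compose_left[symmetric])
      qed
      ultimately have "?S = 0"
        using less.prems dpos by (intro symmetric_admissible_eq_0) auto
      then have "(\<Sum>p\<in>?G. P - permute_vars p P) = of_nat (card ?G) * P"
        by (simp add: sum_subtractf)
      moreover have "lie_symbol I (cst (1 / of_nat (card ?G)) * (\<Sum>p\<in>?G. P - permute_vars p P))"
        using less.prems(1) nonempty perm by (intro lie_symbol.scale lie_symbol_sum) auto
      moreover have "card ?G \<noteq> 0" using less.prems(1) by (simp add: card_permutations[OF refl])
      then have "cst (1 / of_nat (card ?G)) * (of_nat (card ?G) * P) = P"
        by (simp add: fun_eq_iff pointwise of_nat_fun_apply)
      ultimately show ?thesis by simp
    qed
    then show ?thesis using lie_symbol_poisson d by fastforce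
  qed
qed

section \<open>Ring homomorphisms on differential polynomials\<close>

lemma const_mult_single: "const c * Poly_Mapping.single m x = Poly_Mapping.single m (c * x)"
  by (simp add: const_def mult_single)

lemma keys_const_mult: "Poly_Mapping.keys (const c * f) \<subseteq> Poly_Mapping.keys (f :: 'a::monoid_add \<Rightarrow>\<^sub>0 'k::field)"
  using keys_mult[of "const c" f] by (fastforce simp: const_def split: if_splits)

lemma single_sum: "Poly_Mapping.single k (\<Sum>a\<in>A. f a) = (\<Sum>a\<in>A. Poly_Mapping.single k (f a))"
  by (induction A rule: infinite_finite_induct) (simp_all add: single_add)

text \<open>One notion for three gradings: the degree (weight 1), the total order of differentiation
  (weight \<open>snd\<close>), and the exponent reached when x_i becomes e^(a_i z) (weight
  a_i).\<close>

definition weight_sum :: "(nat \<times> nat \<Rightarrow> 'a::comm_semiring_1) \<Rightarrow> diff_monom \<Rightarrow> 'a" where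
  "weight_sum w m = (\<Sum>v\<in>Poly_Mapping.keys m. w v * of_nat (Poly_Mapping.lookup m v))"

lemma weight_sum_superset:
  "finite A \<Longrightarrow> Poly_Mapping.keys m \<subseteq> A \<Longrightarrow>
    weight_sum w m = (\<Sum>v\<in>A. w v * of_nat (Poly_Mapping.lookup m v))"
  unfolding weight_sum_def by (rule sum.mono_neutral_left) (auto simp: in_keys_iff)

lemma weight_sum_add: "weight_sum w (m + m') = weight_sum w m + weight_sum w m'"
proof -
  let ?A = "Poly_Mapping.keys m \<union> Poly_Mapping.keys m'"
  have "Poly_Mapping.keys (m + m') \<subseteq> ?A" by (rule Poly_Mapping.keys_add)
  then show ?thesis
    by (simp add: weight_sum_superset[of ?A] lookup_add distrib_left sum.distrib)
qed

lemma weight_sum_zero [simp]: "weight_sum w 0 = 0"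
  by (simp add: weight_sum_def)

lemma weight_sum_single [simp]: "weight_sum w (Poly_Mapping.single v k) = w v * of_nat k"
  by (subst weight_sum_superset[of "{v}"]) auto

lemma weight_sum_sum: "weight_sum w (\<Sum>i\<in>A. m i) = (\<Sum>i\<in>A. weight_sum w (m i))"
  by (induction A rule: infinite_finite_induct) (auto simp: weight_sum_add)

text \<open>The substitution of t_i^r for x_i^(r), which gives the value at t of the monomial in the
  symbol.\<close>

definition monom_value :: "(nat \<Rightarrow> 'k) \<Rightarrow> diff_monom \<Rightarrow> 'k::field" where
  "monom_value t m = (\<Prod>v\<in>Poly_Mapping.keys m. t (fst v) ^ (snd v * Poly_Mapping.lookup m v))"

lemma monom_value_superset:
  "finite A \<Longrightarrow> Poly_Mapping.keys m \<subseteq> A \<Longrightarrow>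
    monom_value t m = (\<Prod>v\<in>A. t (fst v) ^ (snd v * Poly_Mapping.lookup m v))"
  unfolding monom_value_def by (rule prod.mono_neutral_left) (auto simp: in_keys_iff)

lemma monom_value_add: "monom_value t (m + m') = monom_value t m * monom_value t m'"
proof -
  let ?A = "Poly_Mapping.keys m \<union> Poly_Mapping.keys m'"
  have "Poly_Mapping.keys (m + m') \<subseteq> ?A" by (rule Poly_Mapping.keys_add)
  then show ?thesis
    by (simp add: monom_value_superset[of ?A] lookup_add distrib_left power_add prod.distrib)
qed

lemma monom_value_zero [simp]: "monom_value t 0 = 1"
  by (simp add: monom_value_def)

lemma monom_value_single [simp]: "monom_value t (Poly_Mapping.single (i, r) k) = t i ^ (r * k)"
  by (subst monom_value_superset[of "{(i, r)}"]) auto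

text \<open>Serves two targets: the field, for values of symbols, and the group algebra of the
  integers, for the Witt algebra.\<close>

locale diff_poly_hom =
  fixes emb :: "'k::field \<Rightarrow> 'r::comm_ring_1" and val :: "diff_monom \<Rightarrow> 'r"
  assumes emb_add: "emb (a + b) = emb a + emb b" and emb_mult: "emb (a * b) = emb a * emb b"
    and emb_one: "emb 1 = 1"
    and val_add: "val (m + m') = val m * val m'" and val_zero: "val 0 = 1"
begin

definition hom :: "'k diff_poly \<Rightarrow> 'r" where
  "hom f = (\<Sum>m\<in>Poly_Mapping.keys f. emb (Poly_Mapping.lookup f m) * val m)"

lemma emb_zero: "emb 0 = 0"
  using emb_add[of 0 0] by simp

lemma hom_superset:
  "finite A \<Longrightarrow> Poly_Mapping.keys f \<subseteq> A \<Longrightarrow> hom f = (\<Sum>m\<in>A. emb (Poly_Mapping.lookup f m) * val m)"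
  unfolding hom_def by (rule sum.mono_neutral_left) (auto simp: in_keys_iff emb_zero)

lemma hom_add: "hom (f + g) = hom f + hom g"
proof -
  let ?A = "Poly_Mapping.keys f \<union> Poly_Mapping.keys g"
  have "Poly_Mapping.keys (f + g) \<subseteq> ?A" by (rule Poly_Mapping.keys_add)
  then show ?thesis
    by (simp add: hom_superset[of ?A] lookup_add emb_add distrib_right sum.distrib)
qed

lemma hom_zero [simp]: "hom 0 = 0"
  by (simp add: hom_def)

lemma hom_diff: "hom (f - g) = hom f - hom g"
  using hom_add[of "f - g" g] by simp

lemma hom_sum: "hom (\<Sum>i\<in>A. f i) = (\<Sum>i\<in>A. hom (f i))"
  by (induction A rule: infinite_finite_induct) (auto simp: hom_add)

lemma hom_single: "hom (Poly_Mapping.single m c) = emb c * val m"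
  by (subst hom_superset[of "{m}"]) (auto simp: emb_zero)

lemma hom_const: "hom (const c) = emb c"
  by (simp add: const_def hom_single val_zero)

lemma hom_mult: "hom (f * g) = hom f * hom g"
proof -
  let ?F = "\<lambda>m. Poly_Mapping.single m (Poly_Mapping.lookup f m)"
  let ?G = "\<lambda>m. Poly_Mapping.single m (Poly_Mapping.lookup g m)"
  let ?A = "Poly_Mapping.keys f" and ?B = "Poly_Mapping.keys g"
  have "hom (sum ?F ?A * sum ?G ?B) = hom (sum ?F ?A) * hom (sum ?G ?B)"
    by (simp add: sum_product hom_sum mult_single hom_single emb_mult val_add mult_ac)
  then show ?thesis by (simp flip: diff_poly_sum_single)
qed

end

interpretation evaluation: diff_poly_hom "\<lambda>c :: 'k::field. c" "monom_value t" for t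
  by unfold_locales (simp_all add: monom_value_add)

abbreviation evaluate :: "(nat \<Rightarrow> 'k::field) \<Rightarrow> 'k diff_poly \<Rightarrow> 'k" where
  "evaluate t \<equiv> evaluation.hom t"

lemma evaluate_dvar: "evaluate t (dvar i r) = t i ^ r"
  by (simp add: dvar_def evaluation.hom_single)

section \<open>Values of the symbol as a ring homomorphism\<close>

lemma eval_poly_superset:
  "finite A \<Longrightarrow> Poly_Mapping.keys P \<subseteq> A \<Longrightarrow> eval_poly a P = (\<Sum>m\<in>A. Poly_Mapping.lookup P m *
     (\<Prod>i\<in>Poly_Mapping.keys m. a i ^ Poly_Mapping.lookup m i))"
  unfolding eval_poly_def by (rule sum.mono_neutral_left) (auto simp: in_keys_iff)

lemma eval_poly_add: "eval_poly a (P + Q) = eval_poly a P + eval_poly a Q"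
proof -
  let ?A = "Poly_Mapping.keys P \<union> Poly_Mapping.keys Q"
  have "Poly_Mapping.keys (P + Q) \<subseteq> ?A" by (rule Poly_Mapping.keys_add)
  then show ?thesis
    by (simp add: eval_poly_superset[of ?A] lookup_add distrib_right sum.distrib)
qed

lemma eval_poly_zero: "eval_poly a 0 = 0"
  by (simp add: eval_poly_def)

lemma eval_poly_sum: "eval_poly a (\<Sum>i\<in>A. P i) = (\<Sum>i\<in>A. eval_poly a (P i))"
  by (induction A rule: infinite_finite_induct) (simp_all add: eval_poly_add eval_poly_zero)

lemma eval_poly_single:
  "eval_poly a (Poly_Mapping.single m c) = c * (\<Prod>i\<in>Poly_Mapping.keys m. a i ^ Poly_Mapping.lookup m i)"
  by (subst eval_poly_superset[of "{m}"]) auto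

lemma prod_power_keys_sum:
  fixes a :: "nat \<Rightarrow> 'k::field"
  shows "(\<Prod>i\<in>Poly_Mapping.keys (\<Sum>v\<in>A. Poly_Mapping.single (g v) (k v)).
      a i ^ Poly_Mapping.lookup (\<Sum>v\<in>A. Poly_Mapping.single (g v) (k v)) i) = (\<Prod>v\<in>A. a (g v) ^ k v)"
proof -
  define p where "p m = (\<Prod>i\<in>Poly_Mapping.keys m. a i ^ Poly_Mapping.lookup m i)" for m
  have sup: "p m = (\<Prod>i\<in>B. a i ^ Poly_Mapping.lookup m i)" if "finite B" "Poly_Mapping.keys m \<subseteq> B" for m B
    unfolding p_def by (rule prod.mono_neutral_left) (use that in \<open>auto simp: in_keys_iff\<close>)
  have add: "p (m + m') = p m * p m'" for m m'
  proof -
    let ?B = "Poly_Mapping.keys m \<union> Poly_Mapping.keys m'"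
    have "Poly_Mapping.keys (m + m') \<subseteq> ?B" by (rule Poly_Mapping.keys_add)
    then show ?thesis
      by (simp add: sup[of ?B] lookup_add power_add prod.distrib)
  qed
  have single: "p (Poly_Mapping.single i k) = a i ^ k" for i k
    by (subst sup[of "{i}"]) auto
  have "p (\<Sum>v\<in>A. Poly_Mapping.single (g v) (k v)) = (\<Prod>v\<in>A. a (g v) ^ k v)"
    by (induction A rule: infinite_finite_induct) (auto simp: add single p_def[of 0])
  then show ?thesis by (simp only: p_def)
qed

lemma eval_poly_symbol: "eval_poly a (symbol f) = evaluate a f"
proof -
  have "(\<Prod>i\<in>Poly_Mapping.keys (symbol_monom m). a i ^ Poly_Mapping.lookup (symbol_monom m) i)
      = monom_value a m" for m
    using prod_power_keys_sum[where g = fst and k = "\<lambda>v. snd v * Poly_Mapping.lookup m v"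
        and A = "Poly_Mapping.keys m" and a = a]
    by (simp add: symbol_monom_def split_def monom_value_def)
  then show ?thesis
    by (simp add: symbol_def evaluation.hom_def eval_poly_sum eval_poly_single)
qed

section \<open>Lie elements take values in a subalgebra of the Witt algebra\<close>

text \<open>The Witt algebra is \<open>K[\<int>]\<close> with the Novikov product of the derivation \<open>e\<^sub>c \<mapsto> c e\<^sub>c\<close>. Sending
  \<open>x\<^sub>i\<close> to \<open>e\<^bsub>a\<^sub>i\<^esub>\<close> maps Lie elements into its Lie subalgebra spanned by the \<open>e\<^sub>c\<close> with \<open>c \<le> 1\<close>.\<close>

type_synonym 'k witt = "int \<Rightarrow>\<^sub>0 'k"

text \<open>x_i^(r) goes to a_i^r e_(a_i), the r-th derivative of the image of x_i.\<close>

definition witt_val :: "(nat \<Rightarrow> int) \<Rightarrow> diff_monom \<Rightarrow> 'k::field_char_0 witt" where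
  "witt_val a m = Poly_Mapping.single (weight_sum (\<lambda>v. a (fst v)) m) (monom_value (\<lambda>i. of_int (a i)) m)"

interpretation witt: diff_poly_hom "const :: 'k::field_char_0 \<Rightarrow> 'k witt" "witt_val a" for a
  by unfold_locales
    (simp_all add: const_def witt_val_def single_add mult_single weight_sum_add monom_value_add)

definition witt_deriv :: "'k::field_char_0 witt \<Rightarrow> 'k witt" where
  "witt_deriv g = (\<Sum>c\<in>Poly_Mapping.keys g. Poly_Mapping.single c (of_int c * Poly_Mapping.lookup g c))"

lemma witt_deriv_superset:
  "finite A \<Longrightarrow> Poly_Mapping.keys g \<subseteq> A \<Longrightarrow>
    witt_deriv g = (\<Sum>c\<in>A. Poly_Mapping.single c (of_int c * Poly_Mapping.lookup g c))"
  unfolding witt_deriv_def by (rule sum.mono_neutral_left) (auto simp: in_keys_iff)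

lemma witt_deriv_add: "witt_deriv (f + g) = witt_deriv f + witt_deriv g"
proof -
  let ?A = "Poly_Mapping.keys f \<union> Poly_Mapping.keys g"
  have "Poly_Mapping.keys (f + g) \<subseteq> ?A" by (rule Poly_Mapping.keys_add)
  then show ?thesis
    by (simp add: witt_deriv_superset[of ?A] lookup_add distrib_left single_add sum.distrib)
qed

lemma witt_deriv_sum: "witt_deriv (\<Sum>i\<in>A. f i) = (\<Sum>i\<in>A. witt_deriv (f i))"
  by (induction A rule: infinite_finite_induct) (simp_all add: witt_deriv_add witt_deriv_def[of 0])

lemma witt_deriv_single: "witt_deriv (Poly_Mapping.single c x) = Poly_Mapping.single c (of_int c * x)"
  by (subst witt_deriv_superset[of "{c}"]) auto

lemma monom_remove_var:
  assumes "(v :: nat \<times> nat) \<in> Poly_Mapping.keys m"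
  shows "\<exists>m'. m = m' + Poly_Mapping.single v (1 :: nat) \<and> m - Poly_Mapping.single v 1 = m'"
  by (rule exI[of _ "m - Poly_Mapping.single v 1"])
    (use assms in \<open>auto simp: poly_mapping_eq_iff fun_eq_iff lookup_add lookup_minus lookup_single when_def in_keys_iff\<close>)

lemma witt_val_shift:
  assumes "v \<in> Poly_Mapping.keys m"
  shows "witt_val a (m - Poly_Mapping.single v 1 + Poly_Mapping.single (fst v, Suc (snd v)) 1)
    = const (of_int (a (fst v))) * witt_val a m"
proof -
  obtain m' where m: "m = m' + Poly_Mapping.single v 1" "m - Poly_Mapping.single v 1 = m'"
    using monom_remove_var[OF assms] by blast
  have "monom_value t (Poly_Mapping.single v 1) = t (fst v) ^ snd v" for t :: "nat \<Rightarrow> 'a"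
    using monom_value_single[of t "fst v" "snd v" 1] by simp
  then show ?thesis unfolding m(2)
    by (simp add: m(1) witt_val_def weight_sum_add monom_value_add const_mult_single mult_ac)
qed

lemma witt_deriv_monom: "witt.hom a (deriv_monom m) = witt_deriv (witt_val a m :: 'k::field_char_0 witt)"
proof -
  have "witt.hom a (deriv_monom m) = (\<Sum>(i, r)\<in>Poly_Mapping.keys m.
      const (of_nat (Poly_Mapping.lookup m (i, r))) * (const (of_int (a i)) * witt_val a m) :: 'k witt)"
    unfolding deriv_monom_def witt.hom_sum split_def
    by (rule sum.cong) (simp_all add: witt.hom_single witt_val_shift split_def del: One_nat_def)
  also have "\<dots> = (\<Sum>v\<in>Poly_Mapping.keys m. Poly_Mapping.single 0
      (of_int (a (fst v) * int (Poly_Mapping.lookup m v)))) * witt_val a m"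
    unfolding sum_distrib_right
    by (rule sum.cong) (simp_all add: split_def witt_val_def const_mult_single mult_single mult_ac del: single_of_int)
  also have "(\<Sum>v\<in>Poly_Mapping.keys m. Poly_Mapping.single 0 (of_int (a (fst v) * int (Poly_Mapping.lookup m v))))
      = (Poly_Mapping.single 0 (of_int (weight_sum (\<lambda>v. a (fst v)) m)) :: 'k witt)"
    unfolding weight_sum_def of_int_sum single_sum by simp
  also have "\<dots> * witt_val a m = witt_deriv (witt_val a m)"
    by (simp add: witt_val_def witt_deriv_single mult_single del: single_of_int)
  finally show ?thesis .
qed

text \<open>The substitution is a homomorphism of differential algebras, so it respects the Novikov
  product and its commutator.\<close>

lemma witt_hom_D: "witt.hom a (D f) = witt_deriv (witt.hom a f)"
proof -
  have scale: "const c * witt_deriv g = witt_deriv (const c * g)" for c and g :: "'a witt"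
  proof -
    have "const c * witt_deriv (\<Sum>k\<in>A. Poly_Mapping.single k (x k))
      = witt_deriv (const c * (\<Sum>k\<in>A. Poly_Mapping.single k (x k :: 'a)))" for A x
      by (simp add: sum_distrib_left witt_deriv_sum witt_deriv_single const_mult_single mult_ac)
    from this[of "Poly_Mapping.lookup g" "Poly_Mapping.keys g"] show ?thesis
      by (simp flip: diff_poly_sum_single)
  qed
  show ?thesis
    unfolding D_def witt.hom_sum witt.hom_mult witt.hom_const witt_deriv_monom scale
    by (simp add: witt.hom_def witt_deriv_sum)
qed

lemma witt_bracket_le_1:
  fixes F G :: "'k::field_char_0 witt"
  assumes "Poly_Mapping.keys F \<subseteq> {..1}" "Poly_Mapping.keys G \<subseteq> {..1}"
  shows "Poly_Mapping.keys (F * witt_deriv G - G * witt_deriv F) \<subseteq> {..1}"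
proof -
  let ?x = "Poly_Mapping.lookup F" and ?y = "Poly_Mapping.lookup G"
  let ?A = "Poly_Mapping.keys F" and ?B = "Poly_Mapping.keys G"
  let ?t = "\<lambda>p q. Poly_Mapping.single (p + q) (of_int (q - p) * ?x p * ?y q)"
  have F: "F = (\<Sum>p\<in>?A. Poly_Mapping.single p (?x p))" and G: "G = (\<Sum>q\<in>?B. Poly_Mapping.single q (?y q))"
    by (rule diff_poly_sum_single)+
  have "F * witt_deriv G = (\<Sum>p\<in>?A. \<Sum>q\<in>?B. Poly_Mapping.single (p + q) (of_int q * ?x p * ?y q))"
    by (subst F, subst G) (simp add: witt_deriv_sum witt_deriv_single sum_product mult_single mult_ac)
  moreover have "G * witt_deriv F = (\<Sum>p\<in>?A. \<Sum>q\<in>?B. Poly_Mapping.single (p + q) (of_int p * ?x p * ?y q))"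
    by (subst G, subst F, subst sum.swap)
      (simp add: witt_deriv_sum witt_deriv_single sum_product mult_single mult_ac add.commute)
  ultimately have "F * witt_deriv G - G * witt_deriv F = (\<Sum>p\<in>?A. \<Sum>q\<in>?B. ?t p q)"
    by (simp add: left_diff_distrib single_diff sum_subtractf)
  moreover have le: "Poly_Mapping.keys (?t p q) \<subseteq> {..1}" if "p \<in> ?A" "q \<in> ?B" for p q
  proof (cases "p + q \<le> 1")
    case False
    then have "p = q" using that assms by force
    then show ?thesis by simp
  qed (simp add: subset_singleton_iff)
  have "Poly_Mapping.keys (\<Sum>p\<in>?A. \<Sum>q\<in>?B. ?t p q) \<subseteq> {..1}"
    by (intro order_trans[OF keys_sum] UN_least le)
  ultimately show ?thesis by simp
qed

lemma witt_hom_dvar: "witt.hom a (dvar i r) = Poly_Mapping.single (a i) (of_int (a i) ^ r)"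
  unfolding dvar_def witt.hom_single by (simp add: witt_val_def const_mult_single)

lemma lie_elements_witt:
  assumes "f \<in> lie_elements n" "\<And>i. i \<in> {1..n} \<Longrightarrow> a i \<le> 1"
  shows "Poly_Mapping.keys (witt.hom a f) \<subseteq> {..1}"
  using assms(1) unfolding lie_elements_def
proof induction
  case (gen f)
  then obtain i where "f = dvar i 0" "i \<in> {1..n}" by (auto simp: gens_def)
  then show ?case using assms(2) by (auto simp: witt_hom_dvar)
next
  case (add f g)
  then show ?case using Poly_Mapping.keys_add[of "witt.hom a f" "witt.hom a g"] by (auto simp: witt.hom_add)
next
  case (scale f c)
  then show ?case using keys_const_mult[of c "witt.hom a f"] by (auto simp: witt.hom_mult witt.hom_const)
next
  case (mult f g)
  then show ?case
    using witt_bracket_le_1[OF mult.IH]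
    by (simp add: nov_bracket_def nov_mult_def witt.hom_diff witt.hom_mult witt_hom_D)
qed simp

section \<open>Multilinear differential polynomials\<close>

text \<open>Each variable of I occurs exactly once, with an arbitrary order of differentiation. The
  total order is left free so that the class is closed under \<open>D\<close>.\<close>

inductive multilinear :: "nat set \<Rightarrow> 'k::field_char_0 diff_poly \<Rightarrow> bool" where
  zero: "finite I \<Longrightarrow> multilinear I 0"
| const: "multilinear {} (const c)"
| var: "multilinear I f \<Longrightarrow> i \<notin> I \<Longrightarrow> multilinear (insert i I) (dvar i r * f)"
| add: "multilinear I f \<Longrightarrow> multilinear I g \<Longrightarrow> multilinear I (f + g)"

lemma multilinear_finite: "multilinear I f \<Longrightarrow> finite I"
  by (induction rule: multilinear.induct) auto

lemma multilinear_const_mult: "multilinear I f \<Longrightarrow> multilinear I (const c * f)"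
proof (induction rule: multilinear.induct)
  case (const c')
  have "const c * const c' = (const (c * c') :: 'a diff_poly)" by (simp add: const_def mult_single)
  then show ?case by (simp add: multilinear.const)
next
  case (var I f i r)
  then show ?case using multilinear.var[of I "const c * f" i r] by (simp add: mult.left_commute)
qed (simp_all add: distrib_left multilinear.intros)

lemma multilinear_mult:
  "multilinear I f \<Longrightarrow> multilinear J g \<Longrightarrow> I \<inter> J = {} \<Longrightarrow> multilinear (I \<union> J) (f * g)"
proof (induction rule: multilinear.induct)
  case (zero I)
  then show ?case by (simp add: multilinear.zero multilinear_finite)
next
  case (const c)
  then show ?case by (simp add: multilinear_const_mult)
next
  case (var I f i r)
  then have "multilinear (insert i (I \<union> J)) (dvar i r * (f * g))"
    by (intro multilinear.var) auto
  then show ?case by (simp add: mult.assoc)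
qed (simp add: distrib_right multilinear.add)

lemma multilinear_D: "multilinear I f \<Longrightarrow> multilinear I (D f)"
proof (induction rule: multilinear.induct)
  case (var I f i r)
  then show ?case by (simp add: D_mult D_dvar multilinear.intros)
qed (simp_all add: D_const D_add multilinear.intros)

lemma minus_eq_const: "f - g = f + const (-1) * (g :: 'k::field diff_poly)"
  by (simp add: const_def single_uminus)

lemma multilinear_diff: "multilinear I f \<Longrightarrow> multilinear I g \<Longrightarrow> multilinear I (f - g)"
  unfolding minus_eq_const by (intro multilinear.add multilinear_const_mult)

lemma multilinear_sum:
  "finite I \<Longrightarrow> (\<And>a. a \<in> A \<Longrightarrow> multilinear I (f a)) \<Longrightarrow> multilinear I (\<Sum>a\<in>A. f a)"
  by (induction A rule: infinite_finite_induct) (auto intro: multilinear.zero multilinear.add)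

text \<open>By the Leibniz rule each variable of I is differentiated once more in turn, and since it
  occurs exactly once this multiplies the value by t_i.\<close>

lemma evaluate_D: "multilinear I f \<Longrightarrow> evaluate t (D f) = sum t I * evaluate t f"
proof (induction rule: multilinear.induct)
  case (var I f i r)
  then show ?case
    by (simp add: D_mult D_dvar evaluation.hom_add evaluation.hom_mult evaluate_dvar
        multilinear_finite algebra_simps)
qed (simp_all add: D_const D_add evaluation.hom_add distrib_left)

lemma evaluate_cong: "multilinear I f \<Longrightarrow> (\<And>i. i \<in> I \<Longrightarrow> t i = t' i) \<Longrightarrow> evaluate t f = evaluate t' f"
  by (induction rule: multilinear.induct)
    (auto simp: evaluation.hom_add evaluation.hom_mult evaluate_dvar evaluation.hom_const)

text \<open>A multilinear element is linear in the derivatives of x_n.\<close>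

lemma multilinear_split:
  "multilinear J f \<Longrightarrow> n \<in> J \<Longrightarrow> \<exists>N g. (\<forall>r. multilinear (J - {n}) (g r)) \<and> f = (\<Sum>r<N. dvar n r * g r)"
proof (induction rule: multilinear.induct)
  case (zero I)
  then show ?case by (intro exI[of _ 0] exI[of _ "\<lambda>_. 0"]) (simp add: multilinear.zero)
next
  case (var I f i r)
  show ?case
  proof (cases "i = n")
    case True
    let ?g = "\<lambda>l. if l = r then f else 0"
    have "(\<Sum>l<Suc r. dvar n l * ?g l) = dvar i r * f" using True by simp
    moreover have "multilinear (insert i I - {n}) (?g l)" for l
      using var True multilinear_finite[OF var.hyps(1)] by (simp add: multilinear.zero)
    ultimately show ?thesis by (intro exI[of _ "Suc r"] exI[of _ ?g]) simp
  next
    case False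
    then obtain N g where g: "\<And>l. multilinear (I - {n}) (g l)" "f = (\<Sum>l<N. dvar n l * g l)"
      using var by auto
    have "multilinear (insert i I - {n}) (dvar i r * g l)" for l
      using multilinear.var[OF g(1), of i r l] var False by (simp add: insert_Diff_if)
    moreover have "dvar i r * f = (\<Sum>l<N. dvar n l * (dvar i r * g l))"
      by (simp add: g(2) sum_distrib_left mult.left_commute)
    ultimately show ?thesis by (intro exI[of _ N] exI[of _ "\<lambda>l. dvar i r * g l"] conjI allI)
  qed
next
  case (add I f f')
  then obtain N g N' g' where g: "\<And>r. multilinear (I - {n}) (g r)" "f = (\<Sum>r<N. dvar n r * g r)"
    and g': "\<And>r. multilinear (I - {n}) (g' r)" "f' = (\<Sum>r<N'. dvar n r * g' r)" by blast
  let ?h = "\<lambda>r. (if r < N then g r else 0) + (if r < N' then g' r else 0)"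
  have fin: "finite (I - {n})" using multilinear_finite[OF add.hyps(1)] by simp
  have ext: "(\<Sum>r<max N N'. dvar n r * (if r < L then k r else 0)) = (\<Sum>r<L. dvar n r * k r)"
    if "L \<le> max N N'" for L and k :: "nat \<Rightarrow> 'a diff_poly"
    by (rule sum.mono_neutral_cong_right) (use that in auto)
  have "f + f' = (\<Sum>r<max N N'. dvar n r * ?h r)"
    unfolding distrib_left sum.distrib by (subst (1 2) ext) (simp_all add: g g')
  moreover have "multilinear (I - {n}) (?h r)" for r
    using g g' fin by (intro multilinear.add) (auto intro: multilinear.zero)
  ultimately show ?case by (intro exI[of _ "max N N'"] exI[of _ ?h] conjI allI)
qed simp

lemma power_sum_eq_0_coeffs:
  fixes c :: "nat \<Rightarrow> 'k::field_char_0"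
  assumes "\<And>x. (\<Sum>r<N. x ^ r * c r) = 0" "r < N"
  shows "c r = 0"
proof -
  let ?p = "\<Sum>r<N. monom (c r) r"
  have "poly ?p x = poly 0 x" for x
    using assms(1)[of x] by (simp add: poly_sum poly_monom mult.commute)
  then have "?p = 0" by (metis poly_eq_poly_eq_iff ext)
  then have "coeff ?p r = 0" by simp
  then show ?thesis using assms(2) by (simp add: coeff_sum)
qed

text \<open>As a function of t_n the value is a polynomial whose coefficients are the values of the
  \<open>g r\<close>, and these vanish over an infinite field. Multilinearity is essential: x_i
  x_i'' and (x_i')^2 have the same values.\<close>

lemma evaluate_injective:
  "finite I \<Longrightarrow> multilinear I f \<Longrightarrow> (\<And>t. evaluate t f = 0) \<Longrightarrow> f = 0"
proof (induction I arbitrary: f rule: finite_induct)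
  case empty
  have "J = {} \<Longrightarrow> \<exists>c. f = const c" if "multilinear J f" for J
    using that
  proof (induction rule: multilinear.induct)
    case (zero I) show ?case by (rule exI[of _ 0]) (simp add: const_def)
  next
    case (add I f g)
    then show ?case by (metis const_def single_add)
  qed auto
  then obtain c where "f = const c" using empty by blast
  then show ?case using empty(2)[of 0] by (simp add: evaluation.hom_const) (simp add: const_def)
next
  case (insert n I)
  then obtain N g where g: "\<And>r. multilinear I (g r)" "f = (\<Sum>r<N. dvar n r * g r)"
    using multilinear_split[OF insert.prems(1), of n] by auto
  have "g r = 0" if "r < N" for r
  proof (rule insert.IH[OF g(1)])
    fix t
    have "(\<Sum>r<N. x ^ r * evaluate t (g r)) = 0" for x
    proof -
      have "evaluate (t(n := x)) (g r) = evaluate t (g r)" for r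
        by (rule evaluate_cong[OF g(1)]) (use insert in auto)
      then show ?thesis
        using insert.prems(2)[of "t(n := x)"]
        by (simp add: g(2) evaluation.hom_sum evaluation.hom_mult evaluate_dvar fun_upd_def)
    qed
    then show "evaluate t (g r) = 0" using that by (rule power_sum_eq_0_coeffs)
  qed
  then show ?case by (simp add: g(2))
qed

text \<open>Lifts a Lie symbol to an actual Lie element. Multilinearity is carried along because
  \<open>evaluate_injective\<close> later identifies the lift by its values.\<close>

lemma lie_symbol_realized:
  "lie_symbol I F \<Longrightarrow> I \<subseteq> {1..n} \<Longrightarrow> \<exists>g\<in>lie_elements n. multilinear I g \<and> (\<forall>t. evaluate t g = F t)"
proof (induction rule: lie_symbol.induct)
  case (zero I)
  then show ?case
    by (intro bexI[of _ 0]) (auto simp: multilinear.zero pointwise lie_elements_def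
        intro: generated_subalgebra.zero)
next
  case (gen i)
  have "multilinear {i} (dvar i 0 * const 1 :: 'a diff_poly)"
    by (intro multilinear.intros) auto
  then have "multilinear {i} (dvar i 0 :: 'a diff_poly)" by (simp add: const_def)
  moreover have "(dvar i 0 :: 'a diff_poly) \<in> lie_elements n"
    using gen unfolding lie_elements_def gens_def by (intro generated_subalgebra.gen) auto
  ultimately show ?case by (intro bexI[of _ "dvar i 0"]) (auto simp: evaluate_dvar pointwise)
next
  case (bracket I P J Q)
  then obtain g h where g: "g \<in> lie_elements n" "multilinear I g" "\<And>t. evaluate t g = P t"
    and h: "h \<in> lie_elements n" "multilinear J h" "\<And>t. evaluate t h = Q t" by fastforce
  have "nov_bracket g h \<in> lie_elements n"
    using g(1) h(1) unfolding lie_elements_def by (rule generated_subalgebra.mult)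
  moreover have "multilinear (I \<union> J) (nov_bracket g h)"
    unfolding nov_bracket_def nov_mult_def
    using multilinear_mult[OF g(2) multilinear_D[OF h(2)]] multilinear_mult[OF h(2) multilinear_D[OF g(2)]]
      bracket.hyps by (intro multilinear_diff) (auto simp: Un_commute Int_commute)
  moreover have "evaluate t (nov_bracket g h) = (P * Q * (coord_sum J - coord_sum I)) t" for t
    using g h by (simp add: nov_bracket_def nov_mult_def evaluation.hom_diff evaluation.hom_mult
        evaluate_D[of I] evaluate_D[of J] pointwise algebra_simps)
  ultimately show ?case by blast
next
  case (add I P Q)
  then obtain g h where g: "g \<in> lie_elements n" "multilinear I g" "\<And>t. evaluate t g = P t"
    and h: "h \<in> lie_elements n" "multilinear I h" "\<And>t. evaluate t h = Q t" by fastforce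
  have "g + h \<in> lie_elements n"
    using g(1) h(1) unfolding lie_elements_def by (rule generated_subalgebra.add)
  then show ?case using g h
    by (intro bexI[of _ "g + h"]) (auto simp: evaluation.hom_add pointwise intro: multilinear.add)
next
  case (scale I P c)
  then obtain g where g: "g \<in> lie_elements n" "multilinear I g" "\<And>t. evaluate t g = P t" by fastforce
  have "const c * g \<in> lie_elements n"
    using g(1) unfolding lie_elements_def by (rule generated_subalgebra.scale)
  then show ?case using g
    by (intro bexI[of _ "const c * g"])
      (auto simp: evaluation.hom_mult evaluation.hom_const pointwise intro: multilinear_const_mult)
qed

section \<open>The multilinear component of the free Novikov algebra\<close>

lemma keys_D:
  assumes "k \<in> Poly_Mapping.keys (D g)"
  shows "\<exists>m\<in>Poly_Mapping.keys g. \<exists>(i, r)\<in>Poly_Mapping.keys m.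
    k = m - Poly_Mapping.single (i, r) 1 + Poly_Mapping.single (i, Suc r) 1"
proof -
  have "k \<in> (\<Union>m\<in>Poly_Mapping.keys g. Poly_Mapping.keys (const (Poly_Mapping.lookup g m) * deriv_monom m))"
    using assms unfolding D_def by (rule subsetD[OF keys_sum])
  then obtain m where m: "m \<in> Poly_Mapping.keys g" "k \<in> Poly_Mapping.keys (deriv_monom m :: 'a diff_poly)"
    using keys_const_mult by blast
  have "k \<in> (\<Union>v\<in>Poly_Mapping.keys m. Poly_Mapping.keys (case v of (i, r) \<Rightarrow>
      Poly_Mapping.single (m - Poly_Mapping.single (i, r) 1 + Poly_Mapping.single (i, Suc r) 1)
        (of_nat (Poly_Mapping.lookup m (i, r)) :: 'a)))"
    using m(2) unfolding deriv_monom_def by (rule subsetD[OF keys_sum])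
  then show ?thesis using m by (auto split: if_splits prod.splits)
qed

text \<open>The total order of differentiation is the degree minus one: it is 0 for a generator, and
  f D(g) has order (deg f - 1) + (deg g - 1) + 1.\<close>

lemma Nov_free_keys:
  assumes "f \<in> Nov_free n" "m \<in> Poly_Mapping.keys f"
  shows "fst ` Poly_Mapping.keys m \<subseteq> {1..n} \<and> weight_sum snd m + 1 = weight_sum (\<lambda>_. 1) m"
proof -
  define good where "good m \<longleftrightarrow> fst ` Poly_Mapping.keys m \<subseteq> {1..n} \<and> weight_sum snd m + 1 = weight_sum (\<lambda>_. 1) m"
    for m
  have "\<forall>m\<in>Poly_Mapping.keys f. good m"
    using assms(1) unfolding Nov_free_def
  proof induction
    case (gen f)
    then show ?case by (auto simp: gens_def dvar_def good_def)
  next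
    case (add f g)
    then show ?case using Poly_Mapping.keys_add[of f g] by blast
  next
    case (scale f c)
    then show ?case using keys_const_mult[of c f] by blast
  next
    case (mult f g)
    show ?case
    proof
      fix k assume "k \<in> Poly_Mapping.keys (nov_mult f g)"
      then obtain p q where k: "k = p + q" "p \<in> Poly_Mapping.keys f" "q \<in> Poly_Mapping.keys (D g)"
        using keys_mult[of f "D g"] unfolding nov_mult_def by blast
      obtain m i r where m: "m \<in> Poly_Mapping.keys g" "(i, r) \<in> Poly_Mapping.keys m"
        "q = m - Poly_Mapping.single (i, r) 1 + Poly_Mapping.single (i, Suc r) 1"
        using keys_D[OF k(3)] by fast
      obtain m' where m': "m = m' + Poly_Mapping.single (i, r) 1" "m - Poly_Mapping.single (i, r) 1 = m'"
        using monom_remove_var[OF m(2)] by blast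
      have q: "q = m' + Poly_Mapping.single (i, Suc r) 1" using m(3) m'(2) by simp
      have gm: "good m" "good p" using mult.IH m(1) k(2) by auto
      have "Poly_Mapping.keys m' \<subseteq> Poly_Mapping.keys m"
        by (auto simp: m'(1) in_keys_iff lookup_add)
      moreover have "Poly_Mapping.keys q \<subseteq> Poly_Mapping.keys m' \<union> {(i, Suc r)}"
        unfolding q using Poly_Mapping.keys_add[of m' "Poly_Mapping.single (i, Suc r) 1"] by auto
      moreover have "Poly_Mapping.keys k \<subseteq> Poly_Mapping.keys p \<union> Poly_Mapping.keys q"
        unfolding k(1) by (rule Poly_Mapping.keys_add)
      ultimately have "fst ` Poly_Mapping.keys k \<subseteq> {1..n}"
        using gm m(2) unfolding good_def by fastforce
      moreover have "weight_sum snd k + 1 = weight_sum (\<lambda>_. 1) k"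
        using gm unfolding good_def by (simp add: k(1) q m'(1) weight_sum_add)
      ultimately show "good k" by (simp add: good_def)
    qed
  qed simp
  then show ?thesis using assms(2) unfolding good_def by blast
qed

lemma Nov_keys:
  assumes "f \<in> Nov n" "m \<in> Poly_Mapping.keys f"
  shows "\<exists>\<alpha>. m = (\<Sum>i\<in>{1..n}. Poly_Mapping.single (i, \<alpha> i) 1) \<and> sum \<alpha> {1..n} + 1 = n"
proof -
  have f: "f \<in> Nov_free n" and deg: "\<And>i. i \<in> {1..n} \<Longrightarrow> degree_in i m = 1"
    using assms by (auto simp: Nov_def)
  note good = Nov_free_keys[OF f assms(2)]
  have "\<exists>r. Poly_Mapping.lookup m (i, r) = 1 \<and> (\<forall>r'. r' \<noteq> r \<longrightarrow> Poly_Mapping.lookup m (i, r') = 0)"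
    if i: "i \<in> {1..n}" for i
  proof -
    obtain v where v: "v \<in> Poly_Mapping.keys m" "fst v = i" "Poly_Mapping.lookup m v = 1"
      "\<And>w. w \<in> Poly_Mapping.keys m \<Longrightarrow> fst w = i \<Longrightarrow> v \<noteq> w \<Longrightarrow> Poly_Mapping.lookup m w = 0"
      using deg[OF i] unfolding degree_in_def by (subst (asm) sum_eq_1_iff) auto
    then show ?thesis
      by (intro exI[of _ "snd v"]) (metis fst_conv in_keys_iff prod.collapse snd_conv)
  qed
  then obtain \<alpha> where \<alpha>: "\<And>i. i \<in> {1..n} \<Longrightarrow> Poly_Mapping.lookup m (i, \<alpha> i) = 1"
    "\<And>i r. i \<in> {1..n} \<Longrightarrow> r \<noteq> \<alpha> i \<Longrightarrow> Poly_Mapping.lookup m (i, r) = 0" by metis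
  have m: "m = (\<Sum>i\<in>{1..n}. Poly_Mapping.single (i, \<alpha> i) 1)"
  proof (rule poly_mapping_eqI)
    fix v :: "nat \<times> nat"
    obtain j r where v: "v = (j, r)" by fastforce
    have "Poly_Mapping.lookup (\<Sum>i\<in>{1..n}. Poly_Mapping.single (i, \<alpha> i) (1 :: nat)) v
        = (\<Sum>i\<in>{1..n}. if i = j then of_bool (r = \<alpha> j) else 0)"
      unfolding lookup_sum v by (rule sum.cong) (auto simp: lookup_single when_def)
    also have "\<dots> = Poly_Mapping.lookup m v"
    proof (cases "j \<in> {1..n}")
      case True
      then show ?thesis using \<alpha> by (simp add: v)
    next
      case False
      then have "v \<notin> Poly_Mapping.keys m" using good v by force
      then show ?thesis using False by (auto simp: in_keys_iff)
    qed
    finally show "Poly_Mapping.lookup m v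
      = Poly_Mapping.lookup (\<Sum>i\<in>{1..n}. Poly_Mapping.single (i, \<alpha> i) (1 :: nat)) v" by simp
  qed
  have "weight_sum snd m = sum \<alpha> {1..n}" "weight_sum (\<lambda>_. 1) m = n"
    unfolding m weight_sum_sum by simp_all
  then show ?thesis using m good by auto
qed

lemma Nov_single_prod:
  assumes "m = (\<Sum>i\<in>{1..n}. Poly_Mapping.single (i, \<alpha> i) 1)"
  shows "Poly_Mapping.single m c = const c * (\<Prod>i\<in>{1..n}. dvar i (\<alpha> i) :: 'k::field diff_poly)"
  by (simp add: prod_dvar assms const_def mult_single)

lemma multilinear_prod_dvar:
  "finite I \<Longrightarrow> multilinear I (\<Prod>i\<in>I. dvar i (\<alpha> i) :: 'k::field_char_0 diff_poly)"
proof (induction I rule: finite_induct)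
  case empty
  have "const 1 = (1 :: 'k diff_poly)" by (simp add: const_def)
  then show ?case using multilinear.const[of "1 :: 'k"] by simp
qed (auto intro: multilinear.var)

lemma Nov_multilinear:
  assumes "f \<in> Nov n"
  shows "multilinear {1..n} f"
proof -
  have "multilinear {1..n} (Poly_Mapping.single m (Poly_Mapping.lookup f m))" if m: "m \<in> Poly_Mapping.keys f" for m
    using Nov_keys[OF assms m] by (auto simp: Nov_single_prod intro!: multilinear_const_mult multilinear_prod_dvar)
  then show ?thesis by (subst diff_poly_sum_single) (intro multilinear_sum; simp)
qed

lemma hom_poly_prod_power:
  "finite J \<Longrightarrow> J \<subseteq> I \<Longrightarrow> hom_poly I (sum \<alpha> J) (\<Prod>i\<in>J. coord i ^ \<alpha> i)"
  by (induction J rule: finite_induct)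
    (auto intro: hom_poly_one hom_poly_mult hom_poly_power_coord)

lemma Nov_hom_poly:
  fixes f :: "'k::field_char_0 diff_poly"
  assumes "f \<in> Nov n"
  shows "hom_poly {1..n} (n - 1) (\<lambda>t. evaluate t f)"
proof -
  have "hom_poly {1..n} (n - 1) (\<lambda>t. evaluate t (Poly_Mapping.single m (Poly_Mapping.lookup f m)))"
    if m: "m \<in> Poly_Mapping.keys f" for m
  proof -
    obtain \<alpha> where \<alpha>: "m = (\<Sum>i\<in>{1..n}. Poly_Mapping.single (i, \<alpha> i) 1)" "sum \<alpha> {1..n} + 1 = n"
      using Nov_keys[OF assms m] by blast
    have ev: "evaluate t (\<Prod>i\<in>I. dvar i (\<alpha> i)) = (\<Prod>i\<in>I. t i ^ \<alpha> i)" if "finite I" for I and t :: "nat \<Rightarrow> 'k"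
      using that
    proof (induction I rule: finite_induct)
      case empty
      have "(1 :: 'k diff_poly) = const 1" by (simp add: const_def)
      then show ?case using evaluation.hom_const[of t 1] by simp
    qed (simp add: evaluation.hom_mult evaluate_dvar)
    have pw: "(\<Prod>i\<in>I. coord i ^ \<alpha> i) t = (\<Prod>i\<in>I. t i ^ \<alpha> i)" if "finite I" for I and t :: "nat \<Rightarrow> 'k"
      using that by (induction I rule: finite_induct) (simp_all add: pointwise)
    have "(\<lambda>t. evaluate t (Poly_Mapping.single m (Poly_Mapping.lookup f m)))
        = cst (Poly_Mapping.lookup f m) * (\<Prod>i\<in>{1..n}. coord i ^ \<alpha> i)"
      unfolding Nov_single_prod[OF \<alpha>(1)] by (simp add: fun_eq_iff evaluation.hom_mult evaluation.hom_const ev pw pointwise)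
    moreover have "hom_poly {1..n} (n - 1) (\<Prod>i\<in>{1..n}. coord i ^ \<alpha> i :: 'k poly_fun)"
      using hom_poly_prod_power[of "{1..n}" "{1..n}" \<alpha>] \<alpha>(2) by (metis add_diff_cancel_right' finite_atLeastAtMost order_refl)
    ultimately show ?thesis by (simp only: hom_poly_cst)
  qed
  then have "hom_poly {1..n} (n - 1)
      (\<Sum>m\<in>Poly_Mapping.keys f. (\<lambda>t. evaluate t (Poly_Mapping.single m (Poly_Mapping.lookup f m))))"
    by (intro hom_poly_sum)
  moreover have "(\<Sum>m\<in>Poly_Mapping.keys f. (\<lambda>t. evaluate t (Poly_Mapping.single m (Poly_Mapping.lookup f m))))
      = (\<lambda>t. evaluate t f)"
    by (subst (3) diff_poly_sum_single) (simp add: fun_eq_iff pointwise evaluation.hom_sum)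
  ultimately show ?thesis by simp
qed

text \<open>All monomials of f land on the same basis vector, so the image of f is P_f(a) times it.
  If its index is at least 2, the bound on the exponents of Lie elements forces P_f(a) = 0.\<close>

lemma Nov_witt_hom:
  fixes f :: "'k::field_char_0 diff_poly"
  assumes "f \<in> Nov n"
  shows "witt.hom a f = Poly_Mapping.single (\<Sum>i\<in>{1..n}. a i) (evaluate (\<lambda>i. of_int (a i)) f)"
proof -
  have "witt_val a m = Poly_Mapping.single (\<Sum>i\<in>{1..n}. a i) (monom_value (\<lambda>i. of_int (a i)) m :: 'k)"
    if m: "m \<in> Poly_Mapping.keys f" for m
  proof -
    obtain \<alpha> where "m = (\<Sum>i\<in>{1..n}. Poly_Mapping.single (i, \<alpha> i) 1)"
      using Nov_keys[OF assms m] by blast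
    then have "weight_sum (\<lambda>v. a (fst v)) m = (\<Sum>i\<in>{1..n}. a i)" by (simp add: weight_sum_sum)
    then show ?thesis by (simp add: witt_val_def)
  qed
  then show ?thesis
    by (simp add: witt.hom_def evaluation.hom_def const_mult_single single_sum del: One_nat_def)
qed

theorem theorem1p1:
  fixes n :: nat and f :: "'k::field_char_0 diff_poly"
  assumes "n \<ge> 2" and "f \<in> Nov n"
  shows "f \<in> lie_elements n \<longleftrightarrow> (\<forall>a\<in>V n. eval_poly (\<lambda>i. of_int (a i)) (symbol f) = 0)"
proof
  assume lie: "f \<in> lie_elements n"
  show "\<forall>a\<in>V n. eval_poly (\<lambda>i. of_int (a i)) (symbol f) = 0"
  proof
    fix a assume a: "a \<in> V n"
    then have "Poly_Mapping.keys (witt.hom a f) \<subseteq> {..1}"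
      by (intro lie_elements_witt[OF lie]) (auto simp: V_def)
    moreover have "(\<Sum>i\<in>{1..n}. a i) \<ge> 2" using a by (simp add: V_def)
    ultimately show "eval_poly (\<lambda>i. of_int (a i)) (symbol f) = 0"
      by (auto simp: Nov_witt_hom[OF assms(2)] eval_poly_symbol split: if_splits)
  qed
next
  assume vanish: "\<forall>a\<in>V n. eval_poly (\<lambda>i. of_int (a i)) (symbol f) = 0"
  have "admissible {1..n} (n - 1) (\<lambda>t. evaluate t f)"
    unfolding admissible_def
  proof (intro conjI allI impI)
    fix a :: "nat \<Rightarrow> int"
    assume a: "\<forall>i\<in>{1..n}. a i \<le> 1" "int (card {1..n}) + 1 \<le> sum a {1..n} + int (n - 1)"
    \<comment> \<open>Elements of \<open>V n\<close> are undefined outside {1..n}, whereas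
      admissibility speaks of arbitrary integer functions; the values of f see only the indices in
      {1..n}.\<close>
    then have "restrict a {1..n} \<in> V n" using assms(1) by (auto simp: V_def of_nat_diff)
    then have "evaluate (\<lambda>i. of_int (restrict a {1..n} i)) f = 0"
      using vanish by (simp only: eval_poly_symbol)
    moreover have "evaluate (\<lambda>i. of_int (restrict a {1..n} i)) f = evaluate (\<lambda>i. of_int (a i)) f"
      by (rule evaluate_cong[OF Nov_multilinear[OF assms(2)]]) auto
    ultimately show "evaluate (\<lambda>i. of_int (a i)) f = 0" by simp
  qed (rule Nov_hom_poly[OF assms(2)])
  then have "poisson_symbol {1..n} (card {1..n} - (n - 1)) (\<lambda>t. evaluate t f)"
    using assms(1) by (intro admissible_imp_poisson_symbol) auto
  moreover have "card {1..n} - (n - 1) = 1" using assms(1) by simp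
  ultimately have "lie_symbol {1..n} (\<lambda>t. evaluate t f)" by (simp only: poisson_symbol_1)
  then obtain g where g: "g \<in> lie_elements n" "multilinear {1..n} g" "\<And>t. evaluate t g = evaluate t f"
    using lie_symbol_realized[of "{1..n}" "\<lambda>t. evaluate t f" n] by auto
  \<comment> \<open>f and the Lie element g are multilinear with the same values, hence
    equal.\<close>
  have "f - g = 0"
    by (rule evaluate_injective[OF _ multilinear_diff[OF Nov_multilinear[OF assms(2)] g(2)]])
      (simp_all add: evaluation.hom_diff g(3))
  then show "f \<in> lie_elements n" using g(1) by simp
qed

end
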